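(* Let $p$ be a prime and $G=\mathbb{Z}\times\mathbb{Z}_p=\langle z\rangle\times\langle a\rangle$. Let $\mathcal{S}$ be a Schur ring over $G$ such that $\mathbb{Z}^{(p)}=\langle z^p\rangle$ is an $\mathcal{S}$-subgroup, and write $T(\mathcal{S})=\mathcal{S}\cap F[\mathbb{Z}_p]=F[\mathbb{Z}_p]^{\mathcal{H}}$ with $\mathcal{H}\le\operatorname{Aut}(\mathbb{Z}_p)$ and $|\mathcal{H}|=m$. If $m$ is a power of a prime, then $\mathcal{S}$ is an automorphic Schur ring.
   Context: $F$ is a field of characteristic $0$; $\mathbb{Z}=\langle z\rangle$ infinite cyclic, $\mathbb{Z}_p=\langle a\rangle$ cyclic of order $p$, written multiplicatively. For finite $C\subseteq G$, $\overline{C}=\sum_{g\in C}g$ and $C^*=\{g^{-1}:g\in C\}$. A Schur ring over $G$ is a subspace $\mathcal{S}=\mathrm{Span}_F\{\overline{C}:C\in\mathcal{D}\}$ of $F[G]$, where $\mathcal{D}$ is a partition of $G$ into finite subsets with $\{1\}\in\mathcal{D}$, $C\in\mathcal{D}\Rightarrow C^*\in\mathcal{D}$, and each $\overline{C}\,\overline{D}$ a finite $F$-linear combination of the $\overline{E}$, $E\in\mathcal{D}$; an $\mathcal{S}$-subgroup is a subgroup that is a union of members of $\mathcal{D}$. $\mathbb{Z}_p$ is always an $\mathcal{S}$-subgroup and every Schur ring over $\mathbb{Z}_p$ is $F[\mathbb{Z}_p]^{\mathcal{H}}$ (classes the $\mathcal{H}$-orbits) for some $\mathcal{H}\le\operatorname{Aut}(\mathbb{Z}_p)$.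 $\mathcal{S}$ is automorphic if $\mathcal{S}=F[G]^{\mathcal{H}'}$ (elements fixed by $\mathcal{H}'$) for some finite $\mathcal{H}'\le\operatorname{Aut}(G)$. *)

theory Defs
  imports "HOL-Algebra.Algebra" "HOL-Computational_Algebra.Primes"
begin

text \<open>The group G = Z x Z_p, elements (n,k) with n in Z, k in {0..<p};
  z = (1,0), a = (0,1); written additively in the coordinates.\<close>
definition Gp :: "int \<Rightarrow> (int \<times> int) monoid" where
  "Gp p = \<lparr>carrier = UNIV \<times> {0..<p},
           monoid.mult = (\<lambda>x y. (fst x + fst y, (snd x + snd y) mod p)),
           one = (0, 0)\<rparr>"

definition Zp :: "int \<Rightarrow> int monoid" where
  "Zp p = \<lparr>carrier = {0..<p}, monoid.mult = (\<lambda>x y. (x + y) mod p), one = 0\<rparr>"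

text \<open>Group algebra F[G] over a group with carrier A: finitely supported functions A -> F
  (the element sum_g f(g) g).\<close>
definition galg :: "'g set \<Rightarrow> ('g \<Rightarrow> 'a::field) set" where
  "galg A = {f. finite {g. f g \<noteq> 0} \<and> {g. f g \<noteq> 0} \<subseteq> A}"

definition cls_sum :: "'g set \<Rightarrow> 'g \<Rightarrow> 'a::field" where
  "cls_sum C = (\<lambda>g. if g \<in> C then 1 else 0)"

definition conv :: "('g, 'b) monoid_scheme \<Rightarrow> ('g \<Rightarrow> 'a::field) \<Rightarrow> ('g \<Rightarrow> 'a) \<Rightarrow> 'g \<Rightarrow> 'a" where
  "conv G f h = (\<lambda>g. \<Sum>x\<in>{x. f x \<noteq> 0}. \<Sum>y\<in>{y. h y \<noteq> 0 \<and> x \<otimes>\<^bsub>G\<^esub> y = g}. f x * h y)"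

definition fin_span :: "'g set set \<Rightarrow> ('g \<Rightarrow> 'a::field) set" where
  "fin_span \<D> = {f. \<exists>A c. finite A \<and> A \<subseteq> \<D> \<and> f = (\<lambda>g. \<Sum>E\<in>A. c E * cls_sum E g)}"

definition schur_ring_on :: "('g, 'b) monoid_scheme \<Rightarrow> 'g set set \<Rightarrow> ('g \<Rightarrow> 'a::field) set \<Rightarrow> bool" where
  "schur_ring_on G \<D> S \<longleftrightarrow>
     (\<forall>C\<in>\<D>. C \<noteq> {} \<and> finite C \<and> C \<subseteq> carrier G) \<and>
     (\<forall>C\<in>\<D>. \<forall>D\<in>\<D>. C \<noteq> D \<longrightarrow> C \<inter> D = {}) \<and>
     \<Union>\<D> = carrier G \<and>
     {\<one>\<^bsub>G\<^esub>} \<in> \<D> \<and>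
     (\<forall>C\<in>\<D>. (\<lambda>x. inv\<^bsub>G\<^esub> x) ` C \<in> \<D>) \<and>
     S = fin_span \<D> \<and>
     (\<forall>C\<in>\<D>. \<forall>D\<in>\<D>. conv G (cls_sum C) (cls_sum D) \<in> S)"

definition S_subgroup :: "('g, 'b) monoid_scheme \<Rightarrow> 'g set set \<Rightarrow> 'g set \<Rightarrow> bool" where
  "S_subgroup G \<D> H \<longleftrightarrow> subgroup H G \<and> H = \<Union>{C\<in>\<D>. C \<subseteq> H}"

definition fixed_alg :: "('g, 'b) monoid_scheme \<Rightarrow> ('g \<Rightarrow> 'g) set \<Rightarrow> ('g \<Rightarrow> 'a::field) set" where
  "fixed_alg G H' = {f \<in> galg (carrier G). \<forall>\<sigma>\<in>H'. \<forall>g\<in>carrier G. f (\<sigma> g) = f g}"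

definition automorphic :: "('g, 'b) monoid_scheme \<Rightarrow> ('g \<Rightarrow> 'a::field) set \<Rightarrow> bool" where
  "automorphic G S \<longleftrightarrow> (\<exists>H'. finite H' \<and> subgroup H' (AutoGroup G) \<and> S = fixed_alg G H')"

definition zp_alg :: "int \<Rightarrow> (int \<times> int \<Rightarrow> 'a::field) set" where
  "zp_alg p = {f \<in> galg (carrier (Gp p)). \<forall>g. f g \<noteq> 0 \<longrightarrow> fst g = 0}"

definition zp_fixed :: "int \<Rightarrow> (int \<Rightarrow> int) set \<Rightarrow> (int \<times> int \<Rightarrow> 'a::field) set" where
  "zp_fixed p H = {f \<in> zp_alg p. \<forall>\<sigma>\<in>H. \<forall>k\<in>{0..<p}. f (0, \<sigma> k) = f (0, k)}"

end

theory Submission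
  imports Defs "HOL-Library.Poly_Mapping"
begin

text \<open>The proof compares the classes of different degrees in \<open>z\<close>. Modulo a prime \<open>l\<close>, the
  \<open>l\<close>-th power of a class sum is the sum of the \<open>l\<close>-th powers; for the degrees this shows that a class
  lives in degrees \<open>n\<close> and \<open>-n\<close>, and for \<open>l\<close> other than \<open>p\<close> it shows that multiplication by \<open>l\<close>
  maps the classes of degree \<open>n\<close> onto those of degree \<open>ln\<close>. In degrees other than 0 one can multiply
  the parts of degree \<open>n\<close> and of degree \<open>-n\<close> separately, and since the powers of \<open>z^p\<close> form an
  \<open>S\<close>-subgroup, the resulting partition of \<open>Z_p\<close> into blocks depends only on the degree modulo \<open>p\<close>.

  The blocks of degree \<open>p\<close> other than the trivial one have a common size \<open>s\<close>, which divides \<open>m\<close>. A block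
  \<open>B\<close> of degree 1 satisfies \<open>s | |B| (|B| - 1)\<close>, so \<open>|B|\<close> is 1 or at least \<open>s\<close>, because \<open>s\<close> is
  a prime power. If \<open>B\<close> is not all of \<open>Z_p\<close>, it is invertible modulo \<open>p\<close>, so degree 1 has at
  least as many blocks as degree \<open>p\<close>, and counting points yields a block of size 1. Therefore degree 1
  is a single block or \<open>z\<close> can be replaced by some \<open>z a^t\<close> forming a class with at most one further
  element; in both cases the automorphisms preserving all classes are transitive on each class.\<close>

subsection \<open>Frobenius congruence for sums of group elements\<close>

text \<open>The binomial coefficients strictly between the two ends are multiples of
  \<open>l\<close>, so \<open>l\<close>-th powers are additive modulo \<open>l\<close>; induction on
  \<open>A\<close> extends this from two summands to a finite sum.\<close>

lemma prime_dvd_sum_power_diff: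
  fixes f :: "'b \<Rightarrow> 'a::comm_ring_1"
  assumes l: "Factorial_Ring.prime (l::nat)" and "finite A"
  shows "of_nat l dvd (sum f A ^ l - (\<Sum>x\<in>A. f x ^ l))"
proof -
  have l0: "l > 0" using l by (simp add: prime_gt_0_nat)
  have two: "of_nat l dvd ((x + y) ^ l - (x ^ l + y ^ l))" for x y :: 'a
  proof -
    have "(x + y) ^ l = (\<Sum>k\<le>l. of_nat (l choose k) * x ^ k * y ^ (l - k))"
      by (rule binomial_ring)
    also have "\<dots> = (\<Sum>k\<in>{0,l}. of_nat (l choose k) * x ^ k * y ^ (l - k))
        + (\<Sum>k\<in>{..l} - {0,l}. of_nat (l choose k) * x ^ k * y ^ (l - k))"
      by (subst sum.subset_diff[of "{0,l}"]) (auto simp: add.commute)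
    also have "(\<Sum>k\<in>{0,l}. of_nat (l choose k) * x ^ k * y ^ (l - k)) = x ^ l + y ^ l"
      using l0 by (simp add: add.commute)
    finally have "(x + y) ^ l - (x ^ l + y ^ l)
        = (\<Sum>k\<in>{..l} - {0,l}. of_nat (l choose k) * x ^ k * y ^ (l - k))" by simp
    moreover have "of_nat l dvd (of_nat (l choose k) * x ^ k * y ^ (l - k) :: 'a)"
      if "k \<in> {..l} - {0,l}" for k
    proof -
      have "l dvd (l choose k)" using that l by (intro dvd_choose_prime) auto
      then have "of_nat l dvd (of_nat (l choose k) :: 'a)" by (auto elim!: dvdE)
      then show ?thesis by (simp add: mult.assoc)
    qed
    ultimately show ?thesis by (metis (no_types, lifting) dvd_sum)
  qed
  from \<open>finite A\<close> show ?thesis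
  proof (induction A rule: finite_induct)
    case empty then show ?case using l0 by (simp add: power_0_left)
  next
    case (insert a A)
    have "sum f (insert a A) ^ l - (\<Sum>x\<in>insert a A. f x ^ l)
      = ((f a + sum f A) ^ l - (f a ^ l + sum f A ^ l)) + (sum f A ^ l - (\<Sum>x\<in>A. f x ^ l))"
      using insert.hyps by simp
    then show ?case using two[of "f a" "sum f A"] insert.IH by (simp only: dvd_add)
  qed
qed

text \<open>An element of the group ring of the integers stands for its image in the group ring of the
  integers modulo \<open>N\<close>, and \<open>resid_coeff N P i\<close> is the coefficient of that image at \<open>i\<close>;
  the modulus \<open>0\<close> gives the group ring of the integers itself.\<close>
definition resid_coeff :: "int \<Rightarrow> (int, int) poly_mapping \<Rightarrow> int \<Rightarrow> int" where
  "resid_coeff N P i = (\<Sum>j\<in>Poly_Mapping.keys P. if N dvd j - i then Poly_Mapping.lookup P j else 0)"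

definition set_elem :: "int set \<Rightarrow> (int, int) poly_mapping" where
  "set_elem T = sum (\<lambda>x. Poly_Mapping.single x 1) T"

lemma resid_coeff_superset:
  assumes "finite K" "Poly_Mapping.keys P \<subseteq> K"
  shows "resid_coeff N P i = (\<Sum>j\<in>K. if N dvd j - i then Poly_Mapping.lookup P j else 0)"
  unfolding resid_coeff_def using assms
  by (intro sum.mono_neutral_left) (auto simp: not_in_keys_iff_lookup_eq_zero)

lemma resid_coeff_add: "resid_coeff N (P + Q) i = resid_coeff N P i + resid_coeff N Q i"
proof -
  let ?K = "Poly_Mapping.keys P \<union> Poly_Mapping.keys Q"
  have "Poly_Mapping.keys (P + Q) \<subseteq> ?K" by (rule Poly_Mapping.keys_add)
  then have "resid_coeff N R i = (\<Sum>j\<in>?K. if N dvd j - i then Poly_Mapping.lookup R j else 0)"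
    if "R \<in> {P, Q, P + Q}" for R
    using that by (intro resid_coeff_superset) auto
  then show ?thesis
    by (simp add: sum.distrib[symmetric] lookup_add if_distrib cong: if_cong)
qed

lemma resid_coeff_0 [simp]: "resid_coeff N 0 i = 0"
  by (simp add: resid_coeff_def)

lemma resid_coeff_single [simp]:
  "resid_coeff N (Poly_Mapping.single x c) i = (if N dvd x - i then c else 0)"
  by (simp add: resid_coeff_def)

lemma resid_coeff_sum: "resid_coeff N (\<Sum>a\<in>A. f a) i = (\<Sum>a\<in>A. resid_coeff N (f a) i)"
  by (induction A rule: infinite_finite_induct) (auto simp: resid_coeff_add)

lemma resid_coeff_single_mult:
  "resid_coeff N (Poly_Mapping.single x c * Q) i = c * resid_coeff N Q (i - x)"
proof (induction Q rule: Poly_Mapping.update_induct)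
  case const then show ?case by simp
next
  case (update f a b)
  have *: "Poly_Mapping.update a b f = f + Poly_Mapping.single a b"
    using update.hyps(1)
    by (intro poly_mapping_eqI)
       (auto simp: lookup_update lookup_add lookup_single when_def not_in_keys_iff_lookup_eq_zero)
  have "a - (i - x) = x + a - i" by simp
  then show ?case
    unfolding * using update.IH
    by (simp add: distrib_left resid_coeff_add mult_single algebra_simps)
qed

lemma resid_coeff_sum_single_mult:
  "resid_coeff N ((\<Sum>x\<in>T. Poly_Mapping.single x (c x)) * Q) i
    = (\<Sum>x\<in>T. c x * resid_coeff N Q (i - x))"
  by (simp add: sum_distrib_right resid_coeff_sum resid_coeff_single_mult)

lemma resid_coeff_set_elem_mult:
  "resid_coeff N (set_elem T * Q) i = (\<Sum>x\<in>T. resid_coeff N Q (i - x))"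
  using resid_coeff_sum_single_mult[where c = "\<lambda>_. 1"] by (simp add: set_elem_def)

lemma resid_coeff_cong:
  assumes "N dvd i - j"
  shows "resid_coeff N P i = resid_coeff N P j"
proof -
  have "N dvd k - i \<longleftrightarrow> N dvd k - j" for k
    using assms dvd_add[of N "k - i" "i - j"] dvd_diff[of N "k - j" "i - j"] by auto
  then show ?thesis by (simp add: resid_coeff_def)
qed

lemma resid_coeff_of_nat_mult: "resid_coeff N (of_nat l * Q) i = int l * resid_coeff N Q i"
  by (induction l) (auto simp: resid_coeff_add algebra_simps)

lemma single_1_power: "Poly_Mapping.single x (1::int) ^ k = Poly_Mapping.single (int k * x) 1"
  by (induction k) (auto simp: mult_single algebra_simps single_one)

text \<open>Frobenius congruence at a single coefficient: the \<open>l\<close>-th power of the group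
  element \<open>x\<close> is \<open>l * x\<close> in additive notation, so modulo \<open>l\<close>
  the coefficient at \<open>i\<close> counts the \<open>x\<close> that multiplication by
  \<open>l\<close> sends to \<open>i\<close>.\<close>

lemma resid_coeff_prime_power:
  assumes "Factorial_Ring.prime l" and "finite T"
  shows "int l dvd resid_coeff N (set_elem T ^ l) i - int (card {x \<in> T. N dvd int l * x - i})"
proof -
  have "of_nat l dvd (set_elem T ^ l - (\<Sum>x\<in>T. Poly_Mapping.single (int l * x) 1))"
    using prime_dvd_sum_power_diff[OF assms, of "\<lambda>x. Poly_Mapping.single x (1::int)"]
    by (simp add: set_elem_def single_1_power)
  then obtain Q where "set_elem T ^ l - (\<Sum>x\<in>T. Poly_Mapping.single (int l * x) 1) = of_nat l * Q"
    by (elim dvdE)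
  then have "set_elem T ^ l = (\<Sum>x\<in>T. Poly_Mapping.single (int l * x) 1) + of_nat l * Q"
    by (simp add: algebra_simps)
  then have "resid_coeff N (set_elem T ^ l) i
    = (\<Sum>x\<in>T. if N dvd int l * x - i then 1 else 0) + int l * resid_coeff N Q i"
    by (simp add: resid_coeff_add resid_coeff_sum resid_coeff_of_nat_mult)
  also have "(\<Sum>x\<in>T. if N dvd int l * x - i then 1 else 0::int)
      = int (card {x \<in> T. N dvd int l * x - i})"
    using \<open>finite T\<close> by (simp add: sum.If_cases Int_def)
  finally show ?thesis by simp
qed

section \<open>Two elementary counting facts\<close>

lemma sum_residues_reflect:
  fixes f :: "int \<Rightarrow> 'a::comm_monoid_add"
  assumes "p > 0" and per: "\<And>x y. p dvd x - y \<Longrightarrow> f x = f y"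
  shows "(\<Sum>j\<in>{0..<p}. f (b - j)) = (\<Sum>j\<in>{0..<p}. f j)"
proof -
  have m: "(\<Sum>j\<in>{0..<p}. f (b - j)) = (\<Sum>j\<in>{0..<p}. f ((b - j) mod p))"
    by (intro sum.cong refl per) (simp add: mod_eq_dvd_iff[symmetric])
  show ?thesis unfolding m
    by (rule sum.reindex_bij_witness[of _ "\<lambda>j. (b - j) mod p" "\<lambda>j. (b - j) mod p"])
       (use \<open>p > 0\<close> in \<open>auto simp: mod_diff_right_eq\<close>)
qed

text \<open>Such functions factor through \<open>q\<close>, and a choice \<open>r\<close> of one
  point per fibre inverts the factorization. With \<open>q\<close> a block map, comparing sets of
  functions becomes comparing numbers of blocks.\<close>

lemma card_fibre_constant_functions:
  assumes "finite A"
  shows "card {f \<in> A \<rightarrow>\<^sub>E V. \<forall>i\<in>A. \<forall>j\<in>A. q i = q j \<longrightarrow> f i = f j} = card V ^ card (q ` A)"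
proof -
  let ?F = "{f \<in> A \<rightarrow>\<^sub>E V. \<forall>i\<in>A. \<forall>j\<in>A. q i = q j \<longrightarrow> f i = f j}"
  define r where "r B = (SOME i. i \<in> A \<and> q i = B)" for B
  have rA: "r (q x) \<in> A" and qr: "q (r (q x)) = q x" if "x \<in> A" for x
    using someI[of "\<lambda>i. i \<in> A \<and> q i = q x" x] that by (auto simp: r_def)
  have "bij_betw (\<lambda>v. restrict (v \<circ> q) A) ((q ` A) \<rightarrow>\<^sub>E V) ?F"
  proof (rule bij_betwI[where g = "\<lambda>f. restrict (f \<circ> r) (q ` A)"])
    show "(\<lambda>v. restrict (v \<circ> q) A) \<in> ((q ` A) \<rightarrow>\<^sub>E V) \<rightarrow> ?F"
      by auto
    show "(\<lambda>f. restrict (f \<circ> r) (q ` A)) \<in> ?F \<rightarrow> ((q ` A) \<rightarrow>\<^sub>E V)"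
      using rA by auto
    show "restrict (restrict (v \<circ> q) A \<circ> r) (q ` A) = v"
      if "v \<in> (q ` A) \<rightarrow>\<^sub>E V" for v
    proof (rule extensionalityI[OF restrict_extensional])
      show "v \<in> extensional (q ` A)" using that by (simp add: PiE_def)
      fix B assume "B \<in> q ` A"
      then obtain x where x: "x \<in> A" "B = q x" by blast
      show "restrict (restrict (v \<circ> q) A \<circ> r) (q ` A) B = v B"
        using rA[OF x(1)] qr[OF x(1)] x by simp
    qed
    show "restrict (restrict (f \<circ> r) (q ` A) \<circ> q) A = f" if f: "f \<in> ?F" for f
    proof (rule extensionalityI[OF restrict_extensional])
      show "f \<in> extensional A" using f by (simp add: PiE_def)
      fix x assume x: "x \<in> A"
      have "f (r (q x)) = f x" using f rA[OF x] qr[OF x] x by blast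
      then show "restrict (restrict (f \<circ> r) (q ` A) \<circ> q) A x = f x" using x by simp
    qed
  qed
  then have "card ?F = card ((q ` A) \<rightarrow>\<^sub>E V)" by (simp add: bij_betw_same_card)
  also have "\<dots> = card V ^ card (q ` A)"
    using \<open>finite A\<close> by (subst card_PiE) auto
  finally show ?thesis .
qed

subsection \<open>Degrees of classes\<close>

text \<open>The relation \<open>E n i m j\<close> says that \<open>z^n a^i\<close> and \<open>z^m a^j\<close> lie in the same class, where
  \<open>i\<close> and \<open>j\<close> are read modulo \<open>p\<close>; the classes of degree 0 are the orbits of the
  multipliers in \<open>K\<close>.\<close>
locale schur_classes =
  fixes p :: int and E :: "int \<Rightarrow> int \<Rightarrow> int \<Rightarrow> int \<Rightarrow> bool" and K :: "int set"
  assumes prime_p: "Factorial_Ring.prime p"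
    and E_refl: "p dvd i - j \<Longrightarrow> E n i n j"
    and E_sym: "E n i m j \<Longrightarrow> E m j n i"
    and E_trans: "E n i m j \<Longrightarrow> E m j k l \<Longrightarrow> E n i k l"
    and finite_class: "finite {(m, j). j \<in> {0..<p} \<and> E n i m j}"
    and E_neg: "E n i m j \<Longrightarrow> E (- n) (- i) (- m) (- j)"
    and E_conv: "E a b a' b' \<Longrightarrow>
      card {(m, j). j \<in> {0..<p} \<and> E n i m j \<and> E u v (a - m) (b - j)} =
      card {(m, j). j \<in> {0..<p} \<and> E n i m j \<and> E u v (a' - m) (b' - j)}"
    and E_zero: "E 0 i m j \<longleftrightarrow> m = 0 \<and> (\<exists>h\<in>K. p dvd h * i - j)"
    and E_sub: "E (p * n) 0 m j \<Longrightarrow> p dvd m \<and> p dvd j"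
    and K_range: "K \<subseteq> {1..<p}"
begin

lemma p_gt_1: "p > 1"
  using prime_p by (simp add: prime_gt_1_int)

lemma p_pos [simp]: "p > 0" "p \<noteq> 0" "0 \<le> p"
  using p_gt_1 by auto

lemma E_mod [simp]: "E n (i mod p) m j \<longleftrightarrow> E n i m j" "E n i m (j mod p) \<longleftrightarrow> E n i m j"
proof -
  have "E n i n (i mod p)" "E n (i mod p) n i" for n i
    by (auto intro!: E_refl simp: mod_eq_dvd_iff[symmetric])
  then show "E n (i mod p) m j \<longleftrightarrow> E n i m j" "E n i m (j mod p) \<longleftrightarrow> E n i m j"
    by (meson E_trans)+
qed

lemma E_refl' [simp]: "E n i n i"
  by (rule E_refl) simp

lemma E_cong:
  assumes "p dvd i - i'" "p dvd j - j'"
  shows "E n i m j \<longleftrightarrow> E n i' m j'"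
  using E_mod[of n i m j] E_mod[of n i' m j'] E_mod[of n "i mod p" m j] E_mod[of n "i' mod p" m j']
    assms by (metis E_mod mod_eq_dvd_iff)

lemma E_commute: "E n i m j \<longleftrightarrow> E m j n i"
  by (auto intro: E_sym)

lemma E_neg_iff: "E (- n) (- i) (- m) (- j) \<longleftrightarrow> E n i m j"
  using E_neg E_neg[of "- n" "- i" "- m" "- j"] by auto

section \<open>Class functions and their convolution\<close>

definition cls :: "int \<Rightarrow> int \<Rightarrow> (int \<times> int) set" where
  "cls n i = {(m, j). j \<in> {0..<p} \<and> E n i m j}"

lemma finite_cls [simp]: "finite (cls n i)"
  unfolding cls_def by (rule finite_class)

lemma cls_eq_iff: "cls n i = cls m j \<longleftrightarrow> E n i m j"
proof
  assume *: "cls n i = cls m j"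
  have "(m, j mod p) \<in> cls m j" by (simp add: cls_def)
  then have "(m, j mod p) \<in> cls n i" unfolding * .
  then show "E n i m j" by (simp add: cls_def)
next
  assume "E n i m j"
  then show "cls n i = cls m j" unfolding cls_def using E_sym E_trans by blast
qed

text \<open>These act as elements of the Schur ring with integer values, which permits divisibility
  arguments; the support may be infinite. By \<open>E_refl\<close> they are periodic modulo
  \<open>p\<close> in the second argument.\<close>

definition class_fun :: "(int \<Rightarrow> int \<Rightarrow> int) \<Rightarrow> bool" where
  "class_fun f \<longleftrightarrow> (\<forall>n i m j. E n i m j \<longrightarrow> f n i = f m j)"

lemma class_funD: "class_fun f \<Longrightarrow> E n i m j \<Longrightarrow> f n i = f m j"
  by (simp add: class_fun_def)

lemma class_fun_indicator: "class_fun (\<lambda>m j. of_bool (E n i m j))"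
proof -
  have "E n i a b \<longleftrightarrow> E n i c d" if "E a b c d" for a b c d
    using that E_trans[of n i a b c d] E_trans[of n i c d a b] E_sym[OF that] by blast
  then show ?thesis by (simp add: class_fun_def)
qed

text \<open>The left side is the coefficient at \<open>(a, b)\<close> of \<open>f\<close> times a
  class sum. Sorting the elements of the class by the class of the complementary factor gives a
  combination of the counts in \<open>E_conv\<close>, the structure constants, which agree at
  \<open>(a, b)\<close> and \<open>(a', b')\<close>.\<close>

lemma class_fun_translate_sum:
  assumes f: "class_fun f" and ab: "E a b a' b'"
  shows "(\<Sum>(m, j)\<in>cls n i. f (a - m) (b - j)) = (\<Sum>(m, j)\<in>cls n i. f (a' - m) (b' - j))"
proof -
  define C where "C = cls n i"
  define g where "g c d x = (c - fst x, d - snd x)" for c d :: int and x :: "int \<times> int"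
  define q where "q x = cls (fst x) (snd x)" for x
  \<comment> \<open>\<open>A\<close> collects the complementary factors for both points, so that one
    family of representatives serves both sums.\<close>
  define A where "A = g a b ` C \<union> g a' b' ` C"
  have finC: "finite C" by (simp add: C_def)
  then have finA: "finite (q ` A)" by (simp add: A_def)
  have *: "(\<Sum>(m, j)\<in>C. f (c - m) (d - j))
      = (\<Sum>(u, v)\<in>(\<lambda>B. SOME x. x \<in> A \<and> q x = B) ` q ` A.
          f u v * int (card {(m, j). j \<in> {0..<p} \<and> E n i m j \<and> E u v (c - m) (d - j)}))"
    if "g c d ` C \<subseteq> A" for c d
  proof -
    define r where "r B = (SOME x. x \<in> A \<and> q x = B)" for B
    have qr: "q (r B) = B" if "B \<in> q ` A" for B
      using someI_ex[of "\<lambda>x. x \<in> A \<and> q x = B"] that by (auto simp: r_def)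
    have inj: "inj_on r (q ` A)" using qr by (metis inj_onI)
    have "(\<Sum>(m, j)\<in>C. f (c - m) (d - j)) = (\<Sum>x\<in>C. case g c d x of (u, v) \<Rightarrow> f u v)"
      by (simp add: g_def case_prod_beta)
    also have "\<dots> = (\<Sum>B\<in>q ` A. \<Sum>x\<in>{x \<in> C. q (g c d x) = B}. case g c d x of (u, v) \<Rightarrow> f u v)"
      by (rule sum.group[symmetric]) (use finC finA that in auto)
    also have "\<dots> = (\<Sum>B\<in>q ` A. case r B of (u, v) \<Rightarrow>
          f u v * int (card {(m, j). j \<in> {0..<p} \<and> E n i m j \<and> E u v (c - m) (d - j)}))"
    proof (rule sum.cong[OF refl])
      fix B assume B: "B \<in> q ` A"
      obtain u v where uv: "r B = (u, v)" by force
      have qB: "q x = B \<longleftrightarrow> E u v (fst x) (snd x)" for x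
        using qr[OF B] uv cls_eq_iff[of "fst x" "snd x" u v] by (auto simp: q_def E_commute)
      have "(\<Sum>x\<in>{x \<in> C. q (g c d x) = B}. case g c d x of (u, v) \<Rightarrow> f u v)
        = (\<Sum>x\<in>{x \<in> C. q (g c d x) = B}. f u v)"
        using class_funD[OF f] by (intro sum.cong) (auto simp: qB split: prod.split)
      also have "\<dots> = f u v * int (card {x \<in> C. q (g c d x) = B})" by simp
      moreover have "{x \<in> C. q (g c d x) = B}
        = {(m, j). j \<in> {0..<p} \<and> E n i m j \<and> E u v (c - m) (d - j)}"
        unfolding qB by (auto simp: C_def cls_def g_def)
      ultimately show "(\<Sum>x\<in>{x \<in> C. q (g c d x) = B}. case g c d x of (u, v) \<Rightarrow> f u v)
        = (case r B of (u, v) \<Rightarrow>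
          f u v * int (card {(m, j). j \<in> {0..<p} \<and> E n i m j \<and> E u v (c - m) (d - j)}))"
        by (simp only: uv prod.case)
    qed
    also have "\<dots> = (\<Sum>(u, v)\<in>r ` q ` A.
          f u v * int (card {(m, j). j \<in> {0..<p} \<and> E n i m j \<and> E u v (c - m) (d - j)}))"
      by (subst sum.reindex[OF inj]) (simp add: o_def)
    finally show ?thesis by (simp add: r_def)
  qed
  have "(\<Sum>(m, j)\<in>C. f (a - m) (b - j)) = (\<Sum>(m, j)\<in>C. f (a' - m) (b' - j))"
    using *[of a b] *[of a' b'] E_conv[OF ab] by (simp add: A_def)
  then show ?thesis by (simp add: C_def)
qed

text \<open>\<open>T\<close> is a finite union of classes on each of which \<open>f\<close> is
  constant, so the sum splits into multiples of sums over single classes.\<close>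

lemma class_fun_convolution:
  assumes f: "class_fun f" and g: "class_fun g" and "finite T" and T: "\<And>n i. (n, i) \<in> T \<Longrightarrow> i \<in> {0..<p}"
    and closed: "\<And>n i m j. (n, i) \<in> T \<Longrightarrow> E n i m j \<Longrightarrow> j \<in> {0..<p} \<Longrightarrow> (m, j) \<in> T"
    and ab: "E a b a' b'"
  shows "(\<Sum>(m, j)\<in>T. f m j * g (a - m) (b - j)) = (\<Sum>(m, j)\<in>T. f m j * g (a' - m) (b' - j))"
proof -
  define q where "q x = cls (fst x) (snd x)" for x
  have *: "(\<Sum>(m, j)\<in>T. f m j * g (c - m) (d - j))
    = (\<Sum>B\<in>q ` T. \<Sum>x\<in>{x \<in> T. q x = B}. case x of (m, j) \<Rightarrow> f m j * g (c - m) (d - j))" for c d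
    by (rule sum.group[symmetric]) (use \<open>finite T\<close> in auto)
  have **: "(\<Sum>x\<in>{x \<in> T. q x = B}. case x of (m, j) \<Rightarrow> f m j * g (c - m) (d - j))
     = f n i * (\<Sum>(m, j)\<in>cls n i. g (c - m) (d - j))" if "(n, i) \<in> T" "B = q (n, i)" for n i c d B
  proof -
    have "{x \<in> T. q x = B} = cls n i"
      using that closed[OF that(1)] T
      by (auto simp: q_def cls_eq_iff) (auto simp: cls_def E_commute)
    then show ?thesis
      by (simp add: sum_distrib_left, intro sum.cong)
         (auto simp: cls_def dest: class_funD[OF f])
  qed
  show ?thesis
    unfolding * by (rule sum.cong[OF refl]) (auto simp: ** class_fun_translate_sum[OF g ab])
qed

section \<open>The relation induced on degrees\<close>

definition drel :: "int \<Rightarrow> int \<Rightarrow> bool" where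
  "drel n m \<longleftrightarrow> (\<exists>i j. E n i m j)"

definition slice :: "int \<Rightarrow> int \<Rightarrow> int \<Rightarrow> int set" where
  "slice n i m = {j \<in> {0..<p}. E n i m j}"

lemma finite_slice [simp]: "finite (slice n i m)"
  by (rule finite_subset[of _ "{0..<p}"]) (auto simp: slice_def)

text \<open>Convolving a class with the sum of all of \<open>Z_p\<close>, a union of classes of
  degree 0, replaces each slice by its size, and the product is constant on classes.\<close>

lemma card_slice_drel:
  assumes "drel e e'"
  shows "card (slice n i e) = card (slice n i e')"
proof -
  obtain b b' where E: "E e b e' b'" using assms by (auto simp: drel_def)
  let ?g = "\<lambda>m j. of_bool (E n i m j) :: int"
  have "(\<Sum>(m, j)\<in>{0} \<times> {0..<p}. 1 * ?g (e - m) (b - j))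
      = (\<Sum>(m, j)\<in>{0} \<times> {0..<p}. 1 * ?g (e' - m) (b' - j))"
    by (rule class_fun_convolution[OF _ class_fun_indicator _ _ _ E])
       (auto simp: E_zero class_fun_def)
  then have "(\<Sum>j\<in>{0..<p}. ?g e (b - j)) = (\<Sum>j\<in>{0..<p}. ?g e' (b' - j))"
    by (simp add: sum.cartesian_product[symmetric])
  moreover have "(\<Sum>j\<in>{0..<p}. ?g e (b - j)) = int (card (slice n i e))" for e b
  proof -
    have "(\<Sum>j\<in>{0..<p}. ?g e (b - j)) = (\<Sum>j\<in>{0..<p}. ?g e j)"
      by (rule sum_residues_reflect) (auto simp: E_cong[of i i])
    also have "\<dots> = int (card (slice n i e))"
      by (simp add: slice_def sum.If_cases of_bool_def Int_def)
    finally show ?thesis .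
  qed
  ultimately show ?thesis by simp
qed

text \<open>Slices over related degrees have equal size, so the nonempty slice over \<open>n\<close>
  forces a nonempty one over \<open>m\<close>: a single common class makes every class that meets
  degree \<open>n\<close> meet degree \<open>m\<close>.\<close>

lemma drel_E:
  assumes "drel n m"
  obtains j where "E n i m j" "j \<in> {0..<p}"
proof -
  have "i mod p \<in> slice n i n" by (simp add: slice_def)
  then have "card (slice n i n) \<noteq> 0" by auto
  then have "card (slice n i m) \<noteq> 0" using card_slice_drel[OF assms] by simp
  then obtain j where "j \<in> slice n i m" by (metis card.empty ex_in_conv)
  then show ?thesis using that by (auto simp: slice_def)
qed

lemma drel_refl [simp]: "drel n n"
  unfolding drel_def by (meson E_refl')

lemma drel_sym: "drel n m \<Longrightarrow> drel m n"
proof -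
  assume "drel n m"
  then obtain i j where "E n i m j" by (auto simp: drel_def)
  from E_sym[OF this] show ?thesis by (auto simp: drel_def)
qed

lemma drel_neg: "drel n m \<Longrightarrow> drel (- n) (- m)"
proof -
  assume "drel n m"
  then obtain i j where "E n i m j" by (auto simp: drel_def)
  from E_neg[OF this] show ?thesis by (auto simp: drel_def)
qed

lemma drel_0: "drel 0 m \<Longrightarrow> m = 0"
  by (auto simp: drel_def E_zero)

lemma finite_drel [simp]: "finite {m. drel n m}"
proof -
  have "{m. drel n m} \<subseteq> fst ` cls n 0"
  proof
    fix m assume "m \<in> {m. drel n m}"
    then have "drel n m" by simp
    then obtain j where "E n 0 m j" "j \<in> {0..<p}" by (rule drel_E)
    then have "(m, j) \<in> cls n 0" by (simp add: cls_def)
    then show "m \<in> fst ` cls n 0" by (rule image_eqI[rotated]) simp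
  qed
  then show ?thesis by (rule finite_subset) simp
qed

text \<open>The degrees behave like a Schur ring over the integers: a class projects to each of its
  degrees equally often by \<open>card_slice_drel\<close>, and this nonzero multiplicity
  cancels.\<close>

lemma drel_fun_translate_sum:
  fixes f :: "int \<Rightarrow> int"
  assumes f: "\<And>n m. drel n m \<Longrightarrow> f n = f m" and e: "drel e e'"
  shows "(\<Sum>d\<in>{m. drel n m}. f (e - d)) = (\<Sum>d\<in>{m. drel n m}. f (e' - d))"
proof -
  obtain b b' where E: "E e b e' b'" using e by (auto simp: drel_def)
  have cf: "class_fun (\<lambda>m j. f m)" using f by (auto simp: class_fun_def drel_def)
  have *: "(\<Sum>(m, j)\<in>cls n 0. f (c - m)) = int (card (slice n 0 n)) * (\<Sum>d\<in>{m. drel n m}. f (c - d))" for c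
  proof -
    have "(\<Sum>(m, j)\<in>cls n 0. f (c - m))
      = (\<Sum>d\<in>{m. drel n m}. \<Sum>x\<in>{x \<in> cls n 0. fst x = d}. f (c - fst x))"
    proof -
      have "fst ` cls n 0 \<subseteq> {m. drel n m}" unfolding cls_def drel_def by fastforce
      from sum.group[OF finite_cls finite_drel this, of "\<lambda>x. f (c - fst x)"]
      show ?thesis by (simp only: case_prod_unfold)
    qed
    also have "\<dots> = (\<Sum>d\<in>{m. drel n m}. int (card (slice n 0 n)) * f (c - d))"
    proof (rule sum.cong[OF refl])
      fix d assume d: "d \<in> {m. drel n m}"
      have "bij_betw snd {x \<in> cls n 0. fst x = d} (slice n 0 d)"
        by (rule bij_betwI[where g = "\<lambda>j. (d, j)"]) (auto simp: cls_def slice_def)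
      then have "card {x \<in> cls n 0. fst x = d} = card (slice n 0 n)"
        using card_slice_drel[of n d n 0] d by (simp add: bij_betw_same_card)
      moreover have "(\<Sum>x\<in>{x \<in> cls n 0. fst x = d}. f (c - fst x))
         = (\<Sum>x\<in>{x \<in> cls n 0. fst x = d}. f (c - d))" by (rule sum.cong) auto
      ultimately show "(\<Sum>x\<in>{x \<in> cls n 0. fst x = d}. f (c - fst x))
          = int (card (slice n 0 n)) * f (c - d)" by simp
    qed
    finally show ?thesis by (simp add: sum_distrib_left)
  qed
  have "0 mod p \<in> slice n 0 n" by (simp add: slice_def)
  then have "card (slice n 0 n) \<noteq> 0" by auto
  then show ?thesis
    using class_fun_translate_sum[OF cf E, of n 0] unfolding * by simp
qed

lemma drel_power_const:
  assumes "drel e e'"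
  shows "resid_coeff 0 (set_elem {m. drel n m} ^ k) e = resid_coeff 0 (set_elem {m. drel n m} ^ k) e'"
  using assms
proof (induction k arbitrary: e e')
  case 0
  \<comment> \<open>The zeroth power is the identity, and degree 0 is related only to
    itself.\<close>
  have "e = 0 \<longleftrightarrow> e' = 0" using 0 drel_0[of e] drel_0[of e'] drel_sym[of e e'] by auto
  then show ?case by (auto simp flip: single_one)
next
  case (Suc k)
  show ?case
    by (simp add: resid_coeff_set_elem_mult)
       (rule drel_fun_translate_sum[OF Suc.IH Suc.prems])
qed

text \<open>Modulo \<open>l\<close>, the \<open>l\<close>-th power of the degree class of
  \<open>n\<close> has coefficient 1 at \<open>l * n\<close>, hence also at \<open>e\<close>; a
  coefficient not divisible by \<open>l\<close> occurs only at \<open>l * d\<close> with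
  \<open>d\<close> in that class.\<close>

lemma drel_prime_mult:
  assumes l: "Factorial_Ring.prime (l::nat)" and "drel (int l * n) e"
  shows "\<exists>d. e = int l * d \<and> drel n d"
proof -
  let ?T = "{m. drel n m}"
  have l0: "int l \<noteq> 0" using l by auto
  have a: "int l dvd resid_coeff 0 (set_elem ?T ^ l) x - int (card {d \<in> ?T. int l * d = x})" for x
    using resid_coeff_prime_power[OF l finite_drel, of 0 n x] by simp
  have "{d \<in> ?T. int l * d = int l * n} = {n}" using l0 by auto
  then have "int l dvd resid_coeff 0 (set_elem ?T ^ l) e - 1"
    using a[of "int l * n"] drel_power_const[OF assms(2), of n l] by simp
  from dvd_diff[OF this a[of e]]
  have dvd: "int l dvd int (card {d \<in> ?T. int l * d = e}) - 1" by simp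
  show ?thesis
  proof (rule ccontr)
    assume "\<not> ?thesis"
    then have "{d \<in> ?T. int l * d = e} = {}" by blast
    with dvd have "int l dvd int 0 - 1" by (simp only: card.empty)
    then show False using l by (auto simp: prime_gt_1_nat)
  qed
qed

lemma drel_mult:
  assumes "k > 0" and "drel (int k * n) e"
  shows "\<exists>d. e = int k * d \<and> drel n d"
  using assms
proof (induction k arbitrary: n e rule: prime_divisors_induct)
  case (unit k)
  then show ?case by (intro exI[of _ e]) simp
next
  case (factor l k)
  have "drel (int l * (int k * n)) e" using factor by (simp add: mult.assoc)
  then obtain d where d: "e = int l * d" "drel (int k * n) d"
    using drel_prime_mult[OF factor(1)] by auto
  then obtain d' where "d = int k * d'" "drel n d'"
    using factor by auto
  then show ?case using d by auto
qed auto

text \<open>A positive \<open>m\<close> related to 1 equals \<open>m * 1\<close>, so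
  \<open>drel_mult\<close> makes 1 a multiple of \<open>m\<close>; a negative \<open>m\<close> is
  first reflected.\<close>

lemma drel_1: "drel 1 m \<Longrightarrow> m = 1 \<or> m = -1"
proof -
  assume m: "drel 1 m"
  consider "m > 0" | "m = 0" | "m < 0" by linarith
  then show ?thesis
  proof cases
    case 1
    then have "drel (int (nat m) * 1) 1" using drel_sym[OF m] by simp
    then obtain d where "1 = int (nat m) * d" using drel_mult[of "nat m" 1 1] 1 by auto
    then show ?thesis using 1 pos_zmult_eq_1_iff[of m d] by simp
  next
    case 2
    then show ?thesis using drel_0 drel_sym m by fastforce
  next
    case 3
    have "drel (-m) (-1)" using drel_neg[OF drel_sym[OF m]] .
    then have "drel (int (nat (-m)) * 1) (-1)" using 3 by simp
    then obtain d where "-1 = int (nat (-m)) * d" using drel_mult[of "nat (-m)" 1 "-1"] 3 by auto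
    then have "1 = m * d" using 3 by simp
    then show ?thesis using zmult_eq_1_iff[of m d] by auto
  qed
qed

lemma drel_cases:
  assumes "drel n m"
  shows "m = n \<or> m = - n"
proof -
  have pos: "m = n \<or> m = - n" if n: "n > 0" and nm: "drel n m" for n m
  proof -
    obtain d where "m = n * d" "drel 1 d" using drel_mult[of "nat n" 1 m] n nm by auto
    then show ?thesis using drel_1[of d] by auto
  qed
  consider "n > 0" | "n = 0" | "n < 0" by linarith
  then show ?thesis
    using pos[of n m] pos[of "-n" "-m"] drel_0[of m] assms drel_neg[OF assms] by cases auto
qed

lemma E_deg: "E n i m j \<Longrightarrow> m = n \<or> m = - n"
  using drel_cases[of n m] by (auto simp: drel_def)

text \<open>If \<open>n\<close> and \<open>-n\<close> are related but \<open>k\<close> and \<open>-k\<close> are not, then \<open>{nk}\<close> is a class of degrees,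
  hence so is \<open>{nk + n}\<close>, hence so is their difference \<open>{n}\<close>.\<close>
lemma drel_neg_self:
  assumes "drel n (- n)" "n \<noteq> 0"
  shows "drel k (- k)"
proof -
  have main: "drel k (- k)" if n: "n > 0" "drel n (- n)" and k: "k > 0" for n k
  proof (rule ccontr)
    assume no: "\<not> drel k (- k)"
    have T: "{m. drel n m} = {n, - n}" using drel_cases n by auto
    have nk: "drel (n * k) m \<Longrightarrow> m = n * k" for m
      using drel_mult[of "nat n" k m] n no drel_cases[of k] by auto
    have f: "(of_bool (x = n * k) :: int) = of_bool (y = n * k)" if "drel x y" for x y
      using nk[of x] nk[of y] that drel_sym[OF that] by (cases "x = n * k"; cases "y = n * k") auto
    have one: "drel (n * k + n) m \<Longrightarrow> m = n * k + n" for m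
    proof (rule ccontr)
      assume m: "drel (n * k + n) m" "m \<noteq> n * k + n"
      then have mm: "m = - (n * k + n)" using drel_cases[OF m(1)] by simp
      have pos: "n * k > 0" using n k by simp
      have "(\<Sum>d\<in>{n, - n}. of_bool (n * k + n - d = n * k)) = (\<Sum>d\<in>{n, - n}. of_bool (m - d = n * k) :: int)"
        using drel_fun_translate_sum[of "\<lambda>x. of_bool (x = n * k)", OF f m(1), of n] unfolding T by simp
      moreover have "n \<noteq> - n" "n * k + n + n \<noteq> n * k" "m - n \<noteq> n * k" "m + n \<noteq> n * k"
        unfolding mm using n pos by linarith+
      ultimately show False by simp
    qed
    have g: "(of_bool (x = n * k + n) :: int) = of_bool (y = n * k + n)" if "drel x y" for x y
      using one[of x] one[of y] that drel_sym[OF that]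
      by (cases "x = n * k + n"; cases "y = n * k + n") auto
    have "{m. drel (- (n * k)) m} = {- (n * k)}"
    proof -
      have "m = - (n * k)" if "drel (- (n * k)) m" for m
        using nk[of "- m"] drel_neg[OF that] by simp
      then show ?thesis by auto
    qed
    then have "(of_bool (n + n * k = n * k + n) :: int) = of_bool (- n + n * k = n * k + n)"
      using drel_fun_translate_sum[of "\<lambda>x. of_bool (x = n * k + n)", OF g n(2), of "- (n * k)"] by simp
    then show False using n by simp
  qed
  have n': "drel \<bar>n\<bar> (- \<bar>n\<bar>)" using assms drel_sym by (auto simp: abs_if)
  consider "k > 0" | "k = 0" | "k < 0" by linarith
  then show ?thesis
    using main[OF _ n', of k] main[OF _ n', of "-k"] assms(2) drel_sym by cases auto
qed

end

subsection \<open>Products, periodicity and multipliers\<close>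

lemma exists_inverse_mod_prime:
  fixes p k :: int
  assumes "Factorial_Ring.prime p" "\<not> p dvd k"
  obtains k' where "k' > 0" "\<not> p dvd k'" "p dvd k' * k - 1"
proof -
  have "coprime p k" using assms by (simp add: prime_imp_coprime)
  then obtain u v where uv: "u * p + v * k = 1"
    using bezout_int[of p k] by (auto simp: coprime_iff_gcd_eq_1)
  have p: "p > 1" using assms by (simp add: prime_gt_1_int)
  define k' where "k' = v mod p"
  have "v = k' + p * (v div p)" by (simp add: k'_def)
  then have "k' * k - 1 = k' * k - (u * p + (k' + p * (v div p)) * k)" using uv by simp
  also have "\<dots> = p * (- u - (v div p) * k)" by (simp add: algebra_simps)
  finally have "k' * k - 1 = p * (- u - (v div p) * k)" .
  then have dvd: "p dvd k' * k - 1" by simp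
  have nd: "\<not> p dvd k'"
  proof
    assume "p dvd k'"
    from dvd_diff[OF dvd_mult2[OF this, of k] dvd] show False using p by simp
  qed
  have "k' \<ge> 0" using p by (simp add: k'_def)
  then have "k' > 0" using nd by (cases "k' = 0") auto
  then show ?thesis using dvd nd that by blast
qed

context schur_classes
begin

lemma class_fun_cong: "class_fun f \<Longrightarrow> p dvd x - y \<Longrightarrow> f n x = f n y"
  by (rule class_funD) (auto intro: E_refl)

text \<open>A product of two functions supported in the degrees \<open>\<plusminus>n\<close> and \<open>\<plusminus>k\<close> has degrees
  \<open>\<plusminus>(n + k)\<close> and \<open>\<plusminus>(n - k)\<close>; away from the collisions excluded here its
  components in degrees \<open>\<plusminus>(n + k)\<close> are computed separately for the two signs.\<close>
lemma class_fun_product: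
  assumes f: "class_fun f" and g: "class_fun g" and n: "n \<noteq> 0" "k \<noteq> 0" "n + k \<noteq> 0"
  obtains w where "class_fun w"
    "\<And>e i. e \<in> {1, -1} \<Longrightarrow> w (e * (n + k)) i = (\<Sum>j\<in>{0..<p}. f (e * n) j * g (e * k) (i - j))"
proof -
  \<comment> \<open>Only the degrees \<open>k\<close> and \<open>- k\<close> of \<open>g\<close> are
    kept. Classes do not leave this pair of degrees, so the truncation is still a class function;
    for \<open>f\<close> the range of the sum in \<open>w\<close> has the same effect.\<close>
  define g' where "g' m j = (if m = k \<or> m = - k then g m j else 0)" for m j
  have g': "class_fun g'"
    unfolding class_fun_def
  proof (intro allI impI)
    fix a i b j assume E: "E a i b j"
    then have "b = a \<or> b = - a" by (rule E_deg)
    then have "(a = k \<or> a = - k) \<longleftrightarrow> (b = k \<or> b = - k)" by auto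
    then show "g' a i = g' b j" using class_funD[OF g E] by (simp add: g'_def)
  qed
  define w where "w a b = (\<Sum>(m, j)\<in>{n, - n} \<times> {0..<p}. f m j * g' (a - m) (b - j))" for a b
  have w: "class_fun w"
    unfolding class_fun_def
  proof (intro allI impI)
    fix a i b j assume E: "E a i b j"
    show "w a i = w b j" unfolding w_def
      by (rule class_fun_convolution[OF f g' _ _ _ E]) (use E_deg in force)+
  qed
  have nn: "n \<noteq> - n" using n by simp
  have w2: "w a b = (\<Sum>j\<in>{0..<p}. f n j * g' (a - n) (b - j))
      + (\<Sum>j\<in>{0..<p}. f (- n) j * g' (a + n) (b - j))" for a b
    unfolding w_def using nn by (simp add: sum.cartesian_product[symmetric])
  have "w (e * (n + k)) i = (\<Sum>j\<in>{0..<p}. f (e * n) j * g (e * k) (i - j))" if "e \<in> {1, -1}" for e i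
  proof (cases "e = 1")
    case True
    \<comment> \<open>In degree \<open>n + k\<close> the summand with \<open>f (- n)\<close>
      evaluates \<open>g'\<close> at \<open>n + k + n\<close>, where it vanishes because
      \<open>n\<close> and \<open>n + k\<close> are nonzero.\<close>
    have "n + k + n \<noteq> k" "n + k + n \<noteq> - k" using n by auto
    then show ?thesis using True by (simp add: w2 g'_def)
  next
    case False
    then have e: "e = -1" using that by simp
    have "- n - k - n \<noteq> k" "- n - k - n \<noteq> - k" using n by auto
    then show ?thesis using e by (simp add: w2 g'_def)
  qed
  then show ?thesis using that w by blast
qed

text \<open>\<open>point n t\<close> says that \<open>z^n a^(t 1)\<close> and \<open>z^(-n) a^(t (-1))\<close> together form a union of
  classes.\<close>
definition point :: "int \<Rightarrow> (int \<Rightarrow> int) \<Rightarrow> bool" where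
  "point n t \<longleftrightarrow> (\<exists>f. class_fun f \<and> (\<forall>e\<in>{1, -1}. \<forall>y. f (e * n) y = of_bool (p dvd y - t e)))"

lemma sum_point:
  assumes "\<And>x y. p dvd x - y \<Longrightarrow> f x = f y"
  shows "(\<Sum>j\<in>{0..<p}. f j * of_bool (p dvd l - j - s)) = (f (l - s) :: int)"
proof -
  have "p dvd l - j - s \<longleftrightarrow> j = (l - s) mod p" if "j \<in> {0..<p}" for j
  proof -
    have "p dvd l - j - s \<longleftrightarrow> p dvd (l - s) - j" by (simp add: algebra_simps)
    also have "\<dots> \<longleftrightarrow> (l - s) mod p = j mod p" by (simp add: mod_eq_dvd_iff)
    finally show ?thesis using that by auto
  qed
  then have "(\<Sum>j\<in>{0..<p}. f j * of_bool (p dvd l - j - s))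
    = (\<Sum>j\<in>{0..<p}. if j = (l - s) mod p then f j else 0)"
    by (intro sum.cong) auto
  also have "\<dots> = f ((l - s) mod p)" by simp
  also have "\<dots> = f (l - s)" by (intro assms) (simp add: mod_eq_dvd_iff[symmetric])
  finally show ?thesis .
qed

text \<open>Multiplying the indicator of a class in degrees \<open>n\<close> and \<open>- n\<close>
  by a point translates it by \<open>t\<close> and gives a class function, so elements of one class
  over \<open>n + k\<close> pull back to one class over \<open>n\<close>.\<close>

lemma point_translate:
  assumes pt: "point k t" and n: "n \<noteq> 0" "k \<noteq> 0" "n + k \<noteq> 0" and e: "e \<in> {1, -1}" "e' \<in> {1, -1}"
    and E: "E (e * (n + k)) i (e' * (n + k)) j"
  shows "E (e * n) (i - t e) (e' * n) (j - t e')"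
proof -
  obtain g where g: "class_fun g" "\<And>d y. d \<in> {1, -1} \<Longrightarrow> g (d * k) y = of_bool (p dvd y - t d)"
    using pt unfolding point_def by blast
  let ?f = "\<lambda>m j. of_bool (E (e * n) (i - t e) m j) :: int"
  obtain w where w: "class_fun w" "\<And>d i. d \<in> {1, -1} \<Longrightarrow>
      w (d * (n + k)) i = (\<Sum>j\<in>{0..<p}. ?f (d * n) j * g (d * k) (i - j))"
    by (rule class_fun_product[OF class_fun_indicator g(1) n]) blast
  have "w (d * (n + k)) l = ?f (d * n) (l - t d)" if "d \<in> {1, -1}" for d l
    unfolding w(2)[OF that] g(2)[OF that]
    by (rule sum_point) (rule class_fun_cong[OF class_fun_indicator])
  then have "?f (e * n) (i - t e) = ?f (e' * n) (j - t e')"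
    using class_funD[OF w(1) E] e by metis
  then show ?thesis by simp
qed

lemma point_add:
  assumes "point n t" "point k s" and n: "n \<noteq> 0" "k \<noteq> 0" "n + k \<noteq> 0"
  shows "point (n + k) (\<lambda>e. t e + s e)"
proof -
  obtain f where f: "class_fun f" "\<And>d y. d \<in> {1, -1} \<Longrightarrow> f (d * n) y = of_bool (p dvd y - t d)"
    using assms unfolding point_def by blast
  obtain g where g: "class_fun g" "\<And>d y. d \<in> {1, -1} \<Longrightarrow> g (d * k) y = of_bool (p dvd y - s d)"
    using assms unfolding point_def by blast
  obtain w where w: "class_fun w" "\<And>d i. d \<in> {1, -1} \<Longrightarrow>
      w (d * (n + k)) i = (\<Sum>j\<in>{0..<p}. f (d * n) j * g (d * k) (i - j))"
    by (rule class_fun_product[OF f(1) g(1) n]) blast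
  have "w (d * (n + k)) l = of_bool (p dvd l - (t d + s d))" if "d \<in> {1, -1}" for d l
  proof -
    have "w (d * (n + k)) l = f (d * n) (l - s d)"
      unfolding w(2)[OF that] g(2)[OF that] by (rule sum_point) (rule class_fun_cong[OF f(1)])
    then show ?thesis using f(2)[OF that] by (simp add: algebra_simps)
  qed
  then show ?thesis unfolding point_def using w(1) by blast
qed

lemma point_neg:
  assumes "point n t"
  shows "point (- n) (\<lambda>e. - t e)"
proof -
  obtain f where f: "class_fun f" "\<And>d y. d \<in> {1, -1} \<Longrightarrow> f (d * n) y = of_bool (p dvd y - t d)"
    using assms unfolding point_def by blast
  have "class_fun (\<lambda>m j. f (- m) (- j))"
    unfolding class_fun_def using class_funD[OF f(1)] E_neg by blast
  moreover have "f (- (d * - n)) (- y) = of_bool (p dvd y - - t d)" if "d \<in> {1, -1}" for d y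
  proof -
    have "p dvd - y - t d \<longleftrightarrow> p dvd y + t d"
      using dvd_minus_iff[of p "y + t d"] by (simp add: algebra_simps)
    then show ?thesis using f(2)[OF that, of "- y"] by simp
  qed
  ultimately show ?thesis unfolding point_def by blast
qed

text \<open>By \<open>E_sub\<close> the indicator of the subgroup generated by \<open>z^p\<close> is
  a class function; over degrees divisible by \<open>p\<close> it picks out the zero
  residue.\<close>

lemma point_p: "point (p * k) (\<lambda>_. 0)"
proof -
  let ?f = "\<lambda>a b. of_bool (p dvd a \<and> p dvd b) :: int"
  have one: "p dvd m \<and> p dvd j" if E: "E n i m j" and n: "p dvd n" "p dvd i" for n i m j
  proof -
    obtain n' where "n = p * n'" using n by blast
    then have "E (p * n') 0 m j" using E E_cong[of i 0 j j n m] n by simp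
    then show ?thesis by (rule E_sub)
  qed
  have "class_fun ?f"
    unfolding class_fun_def
  proof (intro allI impI)
    fix n i m j assume E: "E n i m j"
    show "?f n i = ?f m j"
      using one[OF E] one[OF E_sym[OF E]] by (simp only: of_bool_eq_iff) blast
  qed
  moreover have "?f (e * (p * k)) y = of_bool (p dvd y - 0)" for e y by simp
  ultimately show ?thesis unfolding point_def by blast
qed

text \<open>Multiplication by a point of degree \<open>p * k\<close> with shift 0 moves the degree
  and leaves the residues alone. Both degrees must be nonzero, since only then are the two signs
  kept apart.\<close>

lemma E_cong_degree:
  assumes n: "n \<noteq> 0" "n' \<noteq> 0" "p dvd n - n'" and e: "e \<in> {1, -1}" "e' \<in> {1, -1}"
  shows "E (e * n) i (e' * n) j \<longleftrightarrow> E (e * n') i (e' * n') j"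
proof -
  have one: "E (e * n') i (e' * n') j"
    if nz: "n \<noteq> 0" "n' \<noteq> 0" and d: "p dvd n - n'" and E0: "E (e * n) i (e' * n) j" for n n'
  proof (cases "n = n'")
    case False
    obtain k where k: "n - n' = p * k" using d by (elim dvdE)
    then have n: "n = n' + p * k" by simp
    have E: "E (e * (n' + p * k)) i (e' * (n' + p * k)) j"
      using E0 unfolding n .
    have "p * k \<noteq> 0" "n' + p * k \<noteq> 0" using n False nz(1) by auto
    from point_translate[OF point_p nz(2) this e E] show ?thesis by simp
  next
    case True
    show ?thesis using E0 unfolding True .
  qed
  have "p dvd n' - n" using n(3) by (simp only: dvd_diff_commute[of p n' n])
  from one[OF n] one[OF n(2,1) this] show ?thesis by (rule iffI)
qed

section \<open>Powers of a slice and multiplication of degrees by integers\<close>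

lemma resid_coeff_slice:
  "resid_coeff p (set_elem (slice a i m)) l = of_bool (E a i m l)"
proof -
  have "resid_coeff p (set_elem (slice a i m)) l = (\<Sum>x\<in>slice a i m. if p dvd x - l then 1 else 0)"
    by (simp add: set_elem_def resid_coeff_sum)
  also have "\<dots> = (\<Sum>x\<in>slice a i m. if x = l mod p then 1 else 0)"
    by (rule sum.cong) (auto simp: slice_def mod_eq_dvd_iff[symmetric])
  also have "\<dots> = of_bool (l mod p \<in> slice a i m)" by simp
  also have "\<dots> = of_bool (E a i m l)" by (simp add: slice_def)
  finally show ?thesis .
qed

text \<open>\<open>class_fun_product\<close> is iterated: all degrees \<open>k * n\<close> on the
  way are nonzero, so the components for the two signs stay separate and each is a power in the
  group ring of the integers modulo \<open>p\<close>.\<close>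

lemma class_fun_power:
  assumes n: "n \<noteq> 0" and "k \<ge> 1"
  shows "\<exists>w. class_fun w \<and> (\<forall>e\<in>{1, -1}. \<forall>l.
    w (e * (int k * n)) l = resid_coeff p (set_elem (slice a i (e * n)) ^ k) l)"
  using \<open>k \<ge> 1\<close>
proof (induction k rule: dec_induct)
  case base
  show ?case
    using class_fun_indicator[of a i]
    by (intro exI[of _ "\<lambda>m j. of_bool (E a i m j)"]) (simp add: resid_coeff_slice)
next
  case (step k)
  then obtain v where v: "class_fun v" "\<And>e l. e \<in> {1, -1} \<Longrightarrow>
      v (e * (int k * n)) l = resid_coeff p (set_elem (slice a i (e * n)) ^ k) l" by blast
  let ?f = "\<lambda>m j. of_bool (E a i m j) :: int"
  have kn: "int k * n \<noteq> 0" using n step.hyps by simp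
  have "(1 + int k) * n \<noteq> 0" using n by simp
  then have nkn: "n + int k * n \<noteq> 0" by (simp add: distrib_right)
  obtain w where w: "class_fun w" "\<And>e i. e \<in> {1, -1} \<Longrightarrow>
      w (e * (n + int k * n)) i = (\<Sum>j\<in>{0..<p}. ?f (e * n) j * v (e * (int k * n)) (i - j))"
    by (rule class_fun_product[OF class_fun_indicator v(1) n kn nkn]) blast
  have "w (e * (int (Suc k) * n)) l = resid_coeff p (set_elem (slice a i (e * n)) ^ Suc k) l"
    if e: "e \<in> {1, -1}" for e l
  proof -
    let ?R = "\<lambda>l. resid_coeff p (set_elem (slice a i (e * n)) ^ k) l"
    have "w (e * (int (Suc k) * n)) l = w (e * (n + int k * n)) l" by (simp add: algebra_simps)
    also have "\<dots> = (\<Sum>j\<in>{0..<p}. ?f (e * n) j * ?R (l - j))" using w(2)[OF e] v(2)[OF e] by simp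
    also have "\<dots> = (\<Sum>j\<in>slice a i (e * n). ?R (l - j))"
      by (rule sum.mono_neutral_cong_right) (auto simp: slice_def)
    also have "\<dots> = resid_coeff p (set_elem (slice a i (e * n)) ^ Suc k) l"
      by (simp add: resid_coeff_set_elem_mult)
    finally show ?thesis .
  qed
  then show ?case using w(1) by blast
qed

text \<open>The argument of \<open>drel_prime_mult\<close> with residues kept. As \<open>l\<close>
  is invertible modulo \<open>p\<close>, the coefficient at \<open>l * i\<close> is congruent to 1
  modulo \<open>l\<close>; so is the one at \<open>j'\<close>, and \<open>j'\<close> must be the
  image of some \<open>j\<close> in the slice over \<open>e' * n\<close>.\<close>

lemma E_prime_mult:
  assumes l: "Factorial_Ring.prime (l::nat)" "int l \<noteq> p" and n: "n \<noteq> 0" and e: "e \<in> {1, -1}" "e' \<in> {1, -1}"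
    and E: "E (e * (int l * n)) (int l * i) (e' * (int l * n)) j'"
  shows "\<exists>j. p dvd j' - int l * j \<and> E (e * n) i (e' * n) j"
proof -
  have "l \<ge> 1" using l prime_ge_1_nat by blast
  then obtain w where w: "class_fun w" "\<And>d y. d \<in> {1, -1} \<Longrightarrow>
    w (d * (int l * n)) y = resid_coeff p (set_elem (slice (e * n) i (d * n)) ^ l) y"
    using class_fun_power[OF n, of l "e * n" i] by blast
  define c where "c d y = card {x \<in> slice (e * n) i (d * n). p dvd int l * x - y}" for d y
  have w': "int l dvd w (d * (int l * n)) y - int (c d y)" if "d \<in> {1, -1}" for d y
    unfolding w(2)[OF that] c_def by (rule resid_coeff_prime_power) (use l in auto)
  have "coprime p (int l)" using l prime_p by (intro primes_coprime) auto
  then have "p dvd int l * (x - i) \<longleftrightarrow> p dvd x - i" for x by (rule coprime_dvd_mult_right_iff)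
  then have dvd_iff: "p dvd int l * x - int l * i \<longleftrightarrow> x mod p = i mod p" for x
    by (simp only: right_diff_distrib[symmetric] mod_eq_dvd_iff)
  have "{x \<in> slice (e * n) i (e * n). p dvd int l * x - int l * i} = {i mod p}"
    unfolding dvd_iff by (auto simp: slice_def)
  then have "c e (int l * i) = 1" by (simp add: c_def)
  then have "int l dvd w (e' * (int l * n)) j' - 1"
    using w'[OF e(1), of "int l * i"] class_funD[OF w(1) E] by simp
  from dvd_diff[OF this w'[OF e(2), of j']]
  have dvd: "int l dvd int (c e' j') - 1" by simp
  have "c e' j' \<noteq> 0"
  proof
    assume "c e' j' = 0"
    with dvd have "int l dvd int 0 - 1" by (simp only:)
    then show False using l by auto
  qed
  then have "{x \<in> slice (e * n) i (e' * n). p dvd int l * x - j'} \<noteq> {}" unfolding c_def by force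
  then obtain x where "E (e * n) i (e' * n) x" "p dvd int l * x - j'" by (auto simp: slice_def)
  then have "p dvd j' - int l * x \<and> E (e * n) i (e' * n) x"
    by (simp only: dvd_diff_commute[of p j' "int l * x"] simp_thms)
  then show ?thesis by blast
qed

lemma E_nat_mult:
  assumes "k > 0" "\<not> p dvd int k" and n: "n \<noteq> 0" and e: "e \<in> {1, -1}" "e' \<in> {1, -1}"
    and E: "E (e * (int k * n)) (int k * i) (e' * (int k * n)) j'"
  shows "\<exists>j. p dvd j' - int k * j \<and> E (e * n) i (e' * n) j"
  using assms(1,2) n E
proof (induction k arbitrary: n i j' rule: prime_divisors_induct)
  case (unit k)
  then show ?case by (intro exI[of _ j']) simp
next
  case (factor l k)
  have k: "k > 0" "\<not> p dvd int k" "int l \<noteq> p" using factor.prems by auto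
  have "E (e * (int l * (int k * n))) (int l * (int k * i)) (e' * (int l * (int k * n))) j'"
    using factor.prems(4) by (simp add: mult.assoc)
  then obtain y where y: "p dvd j' - int l * y" "E (e * (int k * n)) (int k * i) (e' * (int k * n)) y"
    using E_prime_mult[OF factor.hyps(1) k(3) _ e, of "int k * n" "int k * i" j'] k factor.prems by auto
  obtain j where j: "p dvd y - int k * j" "E (e * n) i (e' * n) j"
    using factor.IH[OF k(1,2) factor.prems(3) y(2)] by blast
  have "j' - int (l * k) * j = (j' - int l * y) + int l * (y - int k * j)"
    by (simp add: algebra_simps)
  then have "p dvd j' - int (l * k) * j" using dvd_add[OF y(1) dvd_mult[OF j(1), of "int l"]] by (simp only:)
  then show ?case using j(2) by blast
qed auto

text \<open>\<open>E_nat_mult\<close> goes down from degree \<open>k * n\<close> to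
  \<open>n\<close>. For the way up, \<open>k'\<close> inverts \<open>k\<close> modulo
  \<open>p\<close>: periodicity replaces degree \<open>n\<close> by \<open>k' * (k * n)\<close>,
  from which \<open>E_nat_mult\<close> goes down to \<open>k * n\<close>.\<close>

lemma E_mult_iff:
  assumes k: "k > 0" "\<not> p dvd k" and n: "n \<noteq> 0" and e: "e \<in> {1, -1}" "e' \<in> {1, -1}"
  shows "E (e * (k * n)) (k * i) (e' * (k * n)) (k * j) \<longleftrightarrow> E (e * n) i (e' * n) j"
proof
  have cop: "coprime p k" using k prime_p by (simp add: prime_imp_coprime)
  assume "E (e * (k * n)) (k * i) (e' * (k * n)) (k * j)"
  then obtain y where y: "p dvd k * j - k * y" "E (e * n) i (e' * n) y"
    using E_nat_mult[of "nat k" n e e' i "k * j"] k n e by auto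
  have "p dvd k * (j - y)" using y(1) by (simp add: algebra_simps)
  then have "p dvd j - y" using cop by (simp add: coprime_dvd_mult_right_iff)
  then show "E (e * n) i (e' * n) j" using y(2) E_cong[of i i j y] by simp
next
  assume E: "E (e * n) i (e' * n) j"
  obtain k' where k': "k' > 0" "\<not> p dvd k'" "p dvd k' * k - 1"
    using exists_inverse_mod_prime[OF prime_p k(2)] .
  have kn: "k * n \<noteq> 0" "k' * (k * n) \<noteq> 0" using k k' n by auto
  have d: "p dvd (k' * k - 1) * m" for m using k'(3) by simp
  have "p dvd k' * (k * n) - n" "p dvd k' * (k * i) - i"
    using d[of n] d[of i] by (simp_all add: algebra_simps)
  then have "E (e * (k' * (k * n))) (k' * (k * i)) (e' * (k' * (k * n))) j"
    using E E_cong_degree[OF kn(2) n _ e] E_cong[of "k' * (k * i)" i j j] by simp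
  then obtain y where y: "p dvd j - k' * y" "E (e * (k * n)) (k * i) (e' * (k * n)) y"
    using E_nat_mult[of "nat k'" "k * n" e e' "k * i" j] k' kn e by auto
  have "y - k * j = - (k * (j - k' * y)) - (k' * k - 1) * y" by (simp add: algebra_simps)
  moreover have "p dvd - (k * (j - k' * y)) - (k' * k - 1) * y"
    using y(1) d[of y] by (intro dvd_diff) (simp_all add: dvd_minus_iff)
  ultimately have "p dvd y - k * j" by (simp only:)
  then show "E (e * (k * n)) (k * i) (e' * (k * n)) (k * j)"
    using y(2) E_cong[of "k * i" "k * i" y "k * j"] by simp
qed

end

subsection \<open>Counting blocks\<close>

lemma prime_power_dvd_mult_coprime:
  fixes a b q :: nat
  assumes "Factorial_Ring.prime q" "q ^ e dvd a * b" "coprime a b"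
  shows "q ^ e dvd a \<or> q ^ e dvd b"
proof (cases "q dvd a")
  case True
  then have "\<not> q dvd b" using assms by (meson coprime_common_divisor_nat not_prime_1 coprime_def not_prime_unit)
  then have "coprime (q ^ e) b" using assms(1) by (simp add: prime_imp_coprime)
  then show ?thesis using assms(2) by (simp add: coprime_dvd_mult_left_iff)
next
  case False
  then have "coprime (q ^ e) a" using assms(1) by (simp add: prime_imp_coprime)
  then show ?thesis using assms(2) by (simp add: coprime_dvd_mult_right_iff)
qed

context schur_classes
begin

text \<open>A structure constant that is nonzero at one element of a class is nonzero at all of
  them.\<close>

lemma translate_support:
  assumes "E a b a' b'" "E n i m j" "E u v (a - m) (b - j)"
  obtains m' j' where "E n i m' j'" "E u v (a' - m') (b' - j')"
proof -
  let ?S = "\<lambda>a b. {(m, j). j \<in> {0..<p} \<and> E n i m j \<and> E u v (a - m) (b - j)}"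
  have fin: "finite (?S c d)" for c d
    by (rule finite_subset[OF _ finite_class[of n i]]) auto
  have "p dvd (b - j mod p) - (b - j)" by (simp add: mod_eq_dvd_iff[symmetric])
  then have "(m, j mod p) \<in> ?S a b"
    using assms(2,3) E_cong[of v v "b - j mod p" "b - j" u "a - m"] by simp
  then have "card (?S a b) > 0" using fin card_gt_0_iff by blast
  then have "card (?S a' b') > 0" using E_conv[OF assms(1), of n i u v] by simp
  then have "?S a' b' \<noteq> {}" by (metis card.empty less_irrefl)
  then show ?thesis using that by blast
qed

text \<open>\<open>z^p a^i\<close> is the product of \<open>a^i\<close> and \<open>z^p\<close>, so
  each member of its class is a product of members of their two classes; by \<open>E_sub\<close> the
  second factor has residue 0.\<close>

lemma E_p_imp_E_0:
  assumes "E p i a b"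
  shows "E 0 i 0 b"
proof -
  obtain m j where mj: "E 0 i m j" "E p 0 (a - m) (b - j)"
    by (rule translate_support[OF assms, of 0 i 0 i p 0]) auto
  have "m = 0" "E 0 i 0 j" using mj(1) E_zero by auto
  moreover have "p dvd b - j" using E_sub[of 1] mj(2) by simp
  ultimately show ?thesis using E_cong[of i i b j 0 0] by simp
qed

text \<open>Here \<open>a^i\<close> is the product of \<open>z^p a^i\<close> and
  \<open>z^(-p)\<close>. The sign \<open>e\<close> stays open, since the factor from the class of
  \<open>z^p a^i\<close> may have degree \<open>- p\<close>.\<close>

lemma E_0_imp_E_p:
  assumes "E 0 i 0 j"
  shows "\<exists>e\<in>{1, -1}. E p i (e * p) j"
proof -
  obtain m l where ml: "E p i m l" "E (- p) 0 (0 - m) (j - l)"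
    by (rule translate_support[OF assms, of p i p i "- p" 0]) auto
  have "p dvd j - l" using E_sub[of "-1"] ml(2) by simp
  then have "E p i m j" using ml(1) E_cong[of i i j l p m] by simp
  moreover have "m = p \<or> m = - p" using E_deg[OF ml(1)] .
  ultimately show ?thesis by auto
qed

text \<open>Multiplication by \<open>k'\<close> leads to degree \<open>k' * p\<close>, and
  periodicity leads back to \<open>p\<close>. Thus all units modulo \<open>p\<close> act as
  symmetries in the degrees \<open>p\<close> and \<open>- p\<close>.\<close>

lemma E_p_mult_iff:
  assumes "\<not> p dvd k" and e: "e \<in> {1, -1}" "e' \<in> {1, -1}"
  shows "E (e * p) (k * i) (e' * p) (k * j) \<longleftrightarrow> E (e * p) i (e' * p) j"
proof -
  define k' where "k' = k mod p"
  have "k' \<ge> 0" "\<not> p dvd k'" using assms(1) by (auto simp: k'_def dvd_mod_iff)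
  then have k': "k' > 0" "\<not> p dvd k'" by (cases "k' = 0"; auto)+
  have "p dvd k - k'" by (simp add: k'_def minus_mod_eq_mult_div)
  then have c: "p dvd k * x - k' * x" for x by (simp add: left_diff_distrib[symmetric])
  have "E (e * p) (k * i) (e' * p) (k * j) \<longleftrightarrow> E (e * p) (k' * i) (e' * p) (k' * j)"
    by (rule E_cong[OF c c])
  also have "\<dots> \<longleftrightarrow> E (e * (k' * p)) (k' * i) (e' * (k' * p)) (k' * j)"
    by (rule E_cong_degree[OF _ _ _ e]) (use k' in auto)
  also have "\<dots> \<longleftrightarrow> E (e * p) i (e' * p) j"
    by (rule E_mult_iff[OF k' _ e]) simp
  finally show ?thesis .
qed

section \<open>Blocks of a fixed degree\<close>

definition blk :: "int \<Rightarrow> int \<Rightarrow> int set" where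
  "blk n i = slice n i n"

definition blocks :: "int \<Rightarrow> int set set" where
  "blocks n = blk n ` {0..<p}"

lemma finite_blk [simp]: "finite (blk n i)"
  by (simp add: blk_def)

lemma finite_blocks [simp]: "finite (blocks n)"
  by (simp add: blocks_def)

lemma mem_blk_iff: "x \<in> blk n i \<longleftrightarrow> x \<in> {0..<p} \<and> E n i n x"
  by (simp add: blk_def slice_def)

lemma blk_self: "i mod p \<in> blk n i"
  by (simp add: mem_blk_iff)

lemma blk_eq_iff: "blk n i = blk n j \<longleftrightarrow> E n i n j"
proof
  assume "blk n i = blk n j"
  then have "j mod p \<in> blk n i" using blk_self by simp
  then show "E n i n j" by (simp add: mem_blk_iff)
next
  assume E: "E n i n j"
  have "E n i n x \<longleftrightarrow> E n j n x" for x
    using E_trans[OF E] E_trans[OF E_sym[OF E]] by (rule iffI[rotated])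
  then show "blk n i = blk n j" by (auto simp: mem_blk_iff)
qed

lemma sum_blocks:
  fixes f :: "int \<Rightarrow> 'b::comm_monoid_add"
  shows "(\<Sum>i\<in>{0..<p}. f i) = (\<Sum>B\<in>blocks n. \<Sum>i\<in>B. f i)"
proof -
  have "(\<Sum>i\<in>{0..<p}. f i) = (\<Sum>B\<in>blocks n. \<Sum>i\<in>{i \<in> {0..<p}. blk n i = B}. f i)"
    by (rule sum.group[symmetric]) (auto simp: blocks_def)
  also have "\<dots> = (\<Sum>B\<in>blocks n. \<Sum>i\<in>B. f i)"
  proof (rule sum.cong[OF refl])
    fix B assume "B \<in> blocks n"
    then obtain j where "B = blk n j" by (auto simp: blocks_def)
    then have "{i \<in> {0..<p}. blk n i = B} = B"
      by (auto simp: blk_eq_iff mem_blk_iff intro: E_sym)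
    then show "(\<Sum>i\<in>{i \<in> {0..<p}. blk n i = B}. f i) = (\<Sum>i\<in>B. f i)" by simp
  qed
  finally show ?thesis .
qed

lemma sum_card_blocks: "(\<Sum>B\<in>blocks n. card B) = nat p"
  using sum_blocks[of "\<lambda>_. 1::nat" n] by simp

lemma blk_p_0: "blk p 0 = {0}"
proof -
  have "x = 0" if "x \<in> blk p 0" for x
  proof -
    have "p dvd x" "x \<in> {0..<p}" using that E_sub[of 1 p x] by (auto simp: mem_blk_iff)
    then show ?thesis using zdvd_not_zless[of x p] by (cases "x = 0") auto
  qed
  moreover have "0 \<in> blk p 0" using blk_self[of 0 p] by simp
  ultimately show ?thesis by auto
qed

text \<open>The number \<open>s\<close> of the introduction: by \<open>card_block_p\<close> the size
  of every block of degree \<open>p\<close> other than \<open>{0}\<close>.\<close>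

definition bsize :: nat where "bsize = card (blk p 1)"

lemma bsize_pos: "bsize > 0"
  unfolding bsize_def using blk_self[of 1 p] by (auto simp: card_gt_0_iff)

lemma card_blk_p_le:
  assumes k: "\<not> p dvd k"
  shows "card (blk p i) \<le> card (blk p (k * i))"
proof (rule card_inj_on_le[where f = "\<lambda>x. (k * x) mod p"])
  have cop: "coprime p k" using k prime_p by (simp add: prime_imp_coprime)
  show "inj_on (\<lambda>x. (k * x) mod p) (blk p i)"
  proof (rule inj_onI)
    fix x y assume xy: "x \<in> blk p i" "y \<in> blk p i" "(k * x) mod p = (k * y) mod p"
    then have "p dvd k * (x - y)" by (simp add: mod_eq_dvd_iff right_diff_distrib)
    then have "x mod p = y mod p" using cop by (simp add: coprime_dvd_mult_right_iff mod_eq_dvd_iff)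
    then show "x = y" using xy by (simp add: mem_blk_iff)
  qed
  show "(\<lambda>x. (k * x) mod p) ` blk p i \<subseteq> blk p (k * i)"
    using E_p_mult_iff[OF k, of 1 1 i] by (auto simp: mem_blk_iff)
qed simp

lemma card_blk_p:
  assumes "\<not> p dvd i"
  shows "card (blk p i) = bsize"
proof (rule antisym)
  show "bsize \<le> card (blk p i)" using card_blk_p_le[OF assms, of 1] by (simp add: bsize_def)
  obtain k where k: "\<not> p dvd k" "p dvd k * i - 1"
    using exists_inverse_mod_prime[OF prime_p assms] by metis
  have "card (blk p i) \<le> card (blk p (k * i))" by (rule card_blk_p_le[OF k(1)])
  also have "blk p (k * i) = blk p 1" unfolding blk_eq_iff by (rule E_refl[OF k(2)])
  finally show "card (blk p i) \<le> bsize" by (simp add: bsize_def)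
qed

lemma card_block_p:
  assumes "B \<in> blocks p" "B \<noteq> {0}"
  shows "card B = bsize"
proof -
  obtain i where i: "i \<in> {0..<p}" "B = blk p i" using assms(1) unfolding blocks_def by blast
  have "i \<noteq> 0" using i assms(2) blk_p_0 by auto
  then have "\<not> p dvd i" using i(1) zdvd_not_zless[of i p] by auto
  then show ?thesis using card_blk_p i(2) by simp
qed

lemma zero_block: "{0} \<in> blocks p"
proof -
  have "0 \<in> {0..<p}" by simp
  then show ?thesis unfolding blocks_def blk_p_0[symmetric] by (rule imageI)
qed

lemma card_blocks_p: "bsize * (card (blocks p) - 1) = nat p - 1" "card (blocks p) \<ge> 1"
proof -
  have "nat p = (\<Sum>B\<in>blocks p. card B)" by (rule sum_card_blocks[symmetric])
  also have "\<dots> = 1 + (\<Sum>B\<in>blocks p - {{0}}. card B)"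
    using sum.remove[OF finite_blocks zero_block, of card] by simp
  also have "(\<Sum>B\<in>blocks p - {{0}}. card B) = (\<Sum>B\<in>blocks p - {{0}}. bsize)"
    by (rule sum.cong) (auto simp: card_block_p)
  also have "\<dots> = bsize * card (blocks p - {{0}})" by simp
  also have "card (blocks p - {{0}}) = card (blocks p) - 1"
    using zero_block by (rule card_Diff_singleton)
  finally show "bsize * (card (blocks p) - 1) = nat p - 1" by simp
  show "card (blocks p) \<ge> 1" using zero_block card_gt_0_iff[of "blocks p"] by auto
qed

lemma K_eq: "K = {x \<in> {0..<p}. E 0 1 0 x}"
proof (rule Set.set_eqI)
  fix x
  have "x = y" if "x \<in> {0..<p}" "y \<in> K" "p dvd y - x" for y
    using that K_range by (metis atLeastAtMost_iff atLeastLessThan_iff mod_eq_dvd_iff mod_pos_pos_trivial subsetD zero_less_one less_imp_le order_trans)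
  moreover have "x \<in> {0..<p}" if "x \<in> K" using that K_range by auto
  ultimately show "x \<in> K \<longleftrightarrow> x \<in> {x \<in> {0..<p}. E 0 1 0 x}"
    using E_zero[of 1 0 x] by force
qed

text \<open>\<open>K\<close> is the class of \<open>a\<close> in degree 0. By
  \<open>E_p_imp_E_0\<close> it is a union of blocks of degree \<open>p\<close>, all of size
  \<open>bsize\<close> because \<open>K\<close> avoids the residue 0.\<close>

lemma bsize_dvd_card_K: "bsize dvd card K"
proof -
  have finK: "finite K" using K_range finite_subset by blast
  have fibre: "{y \<in> K. blk p y = B} = B" if B: "B \<in> blk p ` K" for B
  proof -
    obtain x where x: "x \<in> K" "B = blk p x" using B by (elim imageE)
    have "y \<in> K" if "y \<in> blk p x" for y
    proof -
      have y: "y \<in> {0..<p}" "E 0 x 0 y" using that E_p_imp_E_0[of x p y] by (auto simp: mem_blk_iff)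
      have "E 0 1 0 x" using x(1) K_eq by blast
      from E_trans[OF this y(2)] show ?thesis using y(1) K_eq by blast
    qed
    moreover have "y \<in> blk p x" if "y \<in> K" "E p y p x" for y
      using that K_range E_sym[OF that(2)] by (auto simp: mem_blk_iff)
    moreover have "E p y p x" if "y \<in> blk p x" for y
      using E_sym[of p x p y] that by (simp add: mem_blk_iff)
    ultimately show ?thesis unfolding x(2) blk_eq_iff by blast
  qed
  have "card B = bsize" if B: "B \<in> blk p ` K" for B
  proof -
    obtain x where x: "x \<in> K" "B = blk p x" using B by (elim imageE)
    then have "\<not> p dvd x" using K_range zdvd_not_zless[of x p] by auto
    then show ?thesis using card_blk_p x(2) by simp
  qed
  have "card K = (\<Sum>y\<in>K. 1)" by simp
  also have "\<dots> = (\<Sum>B\<in>blk p ` K. \<Sum>y\<in>{y \<in> K. blk p y = B}. 1)"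
    by (rule sum.group[symmetric]) (use finK in auto)
  also have "\<dots> = (\<Sum>B\<in>blk p ` K. bsize)"
    by (rule sum.cong[OF refl]) (simp only: fibre card_eq_sum[symmetric] \<open>\<And>B. B \<in> blk p ` K \<Longrightarrow> card B = bsize\<close>)
  finally show ?thesis by simp
qed

text \<open>For a block \<open>B\<close> of degree 1 the product of \<open>B\<close> and \<open>B^*\<close> is constant on the blocks of degree
  \<open>p\<close>, which have size \<open>bsize\<close> except for the trivial one, where its coefficient is \<open>|B|\<close>.\<close>
lemma bsize_dvd_card_blk_1: "bsize dvd card (blk 1 i) * (card (blk 1 i) - 1)"
proof -
  define n where "n = card (blk 1 i)"
  \<comment> \<open>The inverse of the block is taken in degree \<open>p - 1\<close> instead of -1,
    which periodicity allows: the product then lies in the nonzero degree \<open>p\<close>, as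
    \<open>class_fun_product\<close> requires.\<close>
  have "p - 1 \<noteq> 0" "1 + (p - 1) \<noteq> 0" using p_gt_1 by auto
  then obtain w where w: "class_fun w" "\<And>e l. e \<in> {1, -1} \<Longrightarrow>
      w (e * (1 + (p - 1))) l = (\<Sum>j\<in>{0..<p}. of_bool (E 1 i (e * 1) j)
        * of_bool (E (p - 1) (- i) (e * (p - 1)) (l - j)))"
    by (rule class_fun_product[OF class_fun_indicator[of 1 i] class_fun_indicator[of "p - 1" "- i"], of 1 "p - 1", rotated 1]) auto
  have "E (p - 1) (- i) (p - 1) l \<longleftrightarrow> E 1 i 1 (- l)" for l
    using E_cong_degree[of "p - 1" "-1" 1 1 "- i" l] p_gt_1 E_neg_iff[of 1 i 1 "- l"] by simp
  \<comment> \<open>The coefficient at \<open>l\<close> counts the pairs of block elements with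
    difference \<open>l\<close>: \<open>n\<close> of them for \<open>l = 0\<close> and
    \<open>n * n\<close> in total.\<close>
  then have wp: "w p l = (\<Sum>j\<in>{0..<p}. of_bool (E 1 i 1 j) * of_bool (E 1 i 1 (j - l)))" for l
    using w(2)[of 1 l] by simp
  have sum1: "(\<Sum>l\<in>{0..<p}. of_bool (E 1 i 1 l)) = int n"
    by (simp add: n_def blk_def slice_def of_bool_def sum.If_cases Int_def)
  have w0: "w p 0 = int n" using sum1 by (simp add: wp of_bool_conj[symmetric])
  have inner: "(\<Sum>l\<in>{0..<p}. of_bool (E 1 i 1 (j - l))) = int n" for j
    unfolding sum1[symmetric]
    by (rule sum_residues_reflect[OF p_pos(1)]) (rule class_fun_cong[OF class_fun_indicator])
  have "(\<Sum>l\<in>{0..<p}. w p l)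
     = (\<Sum>j\<in>{0..<p}. of_bool (E 1 i 1 j) * (\<Sum>l\<in>{0..<p}. of_bool (E 1 i 1 (j - l))))"
    unfolding wp by (subst sum.swap) (simp only: sum_distrib_left)
  also have "\<dots> = int n * int n"
    unfolding inner sum_distrib_right[symmetric] sum1 ..
  finally have tot: "(\<Sum>l\<in>{0..<p}. w p l) = int n * int n" .
  have "int bsize dvd (\<Sum>l\<in>B. w p l)" if B: "B \<in> blocks p - {{0}}" for B
  proof -
    obtain j where j: "B = blk p j" using B by (auto simp: blocks_def)
    have "(\<Sum>l\<in>B. w p l) = (\<Sum>l\<in>B. w p j)"
      by (rule sum.cong) (use class_funD[OF w(1)] j in \<open>auto simp: mem_blk_iff\<close>)
    also have "\<dots> = int bsize * w p j" using card_block_p B by simp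
    finally show ?thesis by simp
  qed
  then have "int bsize dvd (\<Sum>B\<in>blocks p - {{0}}. \<Sum>l\<in>B. w p l)" by (rule dvd_sum)
  also have "\<dots> = (\<Sum>B\<in>blocks p. \<Sum>l\<in>B. w p l) - int n"
    using sum.remove[OF finite_blocks zero_block, of "\<lambda>B. \<Sum>l\<in>B. w p l"] by (simp add: w0)
  also have "\<dots> = int n * int n - int n" by (simp add: sum_blocks[of "w p" p, symmetric] tot)
  also have "\<dots> = int (n * (n - 1))" by (cases n) (auto simp: algebra_simps)
  finally show ?thesis by (simp only: n_def of_nat_dvd_iff)
qed

section \<open>Comparing the numbers of blocks in degrees \<open>p\<close> and 1\<close>

lemma resid_coeff_blk: "resid_coeff p (set_elem (blk n i)) l = of_bool (E n i n l)"
  by (simp add: blk_def resid_coeff_slice)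

lemma dvd_resid_coeff_power_mult:
  assumes "\<And>l. c dvd resid_coeff N Q l"
  shows "c dvd resid_coeff N (set_elem T ^ k * Q) l"
proof (induction k arbitrary: l)
  case (Suc k)
  then show ?case by (simp add: mult.assoc resid_coeff_set_elem_mult dvd_sum)
qed (simp add: assms)

text \<open>A proper block \<open>T\<close> of degree 1 is invertible modulo \<open>p\<close>, because \<open>T^p\<close> is congruent to
  \<open>|T|\<close>. Multiplication by \<open>T\<close> thus embeds the functions modulo \<open>p\<close> on the blocks of degree
  \<open>p\<close> into those on the blocks of degree \<open>p + 1\<close>.\<close>
lemma card_blocks_le:
  assumes T: "card (blk 1 i) < nat p"
  shows "card (blocks p) \<le> card (blocks 1)"
proof -
  define A where "A = {0..<p}"
  \<comment> \<open>With \<open>A\<close> standing for the residues, \<open>F n\<close> is the set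
    of functions modulo \<open>p\<close> on the blocks of degree \<open>n\<close>; its size is
    \<open>p\<close> to the number of blocks.\<close>
  define F where "F n = {f \<in> A \<rightarrow>\<^sub>E A. \<forall>i\<in>A. \<forall>j\<in>A. blk n i = blk n j \<longrightarrow> f i = f j}" for n
  have finA: "finite A" by (simp add: A_def)
  have cardF: "card (F n) = nat p ^ card (blocks n)" for n
    unfolding F_def by (subst card_fibre_constant_functions[OF finA]) (simp add: A_def blocks_def)
  have finF: "finite (F n)" for n
    by (rule finite_subset[of _ "A \<rightarrow>\<^sub>E A"]) (auto simp: F_def finA intro: finite_PiE)
  define h where "h f l = (\<Sum>j\<in>A. f j * of_bool (E 1 i 1 (l - j)))" for f :: "int \<Rightarrow> int" and l
  define G where "G f = restrict (\<lambda>l. h f l mod p) A" for f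
  have hconst: "h f l = h f l'" if f: "f \<in> F p" and E: "E 1 l 1 l'" for f l l'
  proof -
    \<comment> \<open>\<open>f\<close> is extended from degree \<open>p\<close> to all classes, with
      value 0 on those that do not meet degree \<open>p\<close>.\<close>
    define f' where "f' m x = (if \<exists>j\<in>A. E p j m x then f (SOME j. j \<in> A \<and> E p j m x) else 0)" for m x
    have cf: "class_fun f'"
      unfolding class_fun_def
    proof (intro allI impI)
      fix n a m b assume E: "E n a m b"
      have "E p j n a \<longleftrightarrow> E p j m b" for j using E_trans[OF _ E] E_trans[OF _ E_sym[OF E]] by blast
      then show "f' n a = f' m b" by (simp add: f'_def)
    qed
    have f': "f' p x = f x" if "x \<in> A" for x
    proof -
      have ex: "x \<in> A \<and> E p x p x" using that by simp
      define r where "r = (SOME j. j \<in> A \<and> E p j p x)"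
      have r: "r \<in> A" "E p r p x" using someI[of "\<lambda>j. j \<in> A \<and> E p j p x", OF ex] by (auto simp: r_def)
      have "blk p r = blk p x" using r(2) by (simp add: blk_eq_iff)
      then have fr: "f r = f x" using f r(1) that unfolding F_def by blast
      have "\<exists>j\<in>A. E p j p x" using r by blast
      then have "f' p x = f r" by (simp add: f'_def r_def)
      then show ?thesis using fr by simp
    qed
    have "p + 1 \<noteq> 0" using p_gt_1 by simp
    then obtain w where w: "class_fun w" "\<And>e l. e \<in> {1, -1} \<Longrightarrow>
      w (e * (p + 1)) l = (\<Sum>j\<in>{0..<p}. f' (e * p) j * of_bool (E 1 i (e * 1) (l - j)))"
      by (rule class_fun_product[OF cf class_fun_indicator[of 1 i], of p 1, rotated 2]) auto
    have "w (p + 1) l = h f l" for l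
      using w(2)[of 1 l] f' by (simp add: h_def A_def)
    \<comment> \<open>The product has degree \<open>p + 1\<close>, which periodicity identifies with
      degree 1.\<close>
    moreover have "E (p + 1) l (p + 1) l'"
      using E E_cong_degree[of "p + 1" 1 1 1 l l'] \<open>p + 1 \<noteq> 0\<close> by simp
    ultimately show ?thesis using class_funD[OF w(1)] by metis
  qed
  have "G f \<in> F 1" if "f \<in> F p" for f
  proof -
    have hb: "h f i = h f j" if "blk 1 i = blk 1 j" for i j
      using hconst[OF \<open>f \<in> F p\<close>, of i j] that by (simp only: blk_eq_iff)
    show ?thesis
      unfolding F_def mem_Collect_eq
    proof (intro conjI ballI impI)
      show "G f \<in> A \<rightarrow>\<^sub>E A" unfolding G_def by (rule restrict_PiE_iff[THEN iffD2]) (simp add: A_def)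
      fix i j assume "i \<in> A" "j \<in> A" "blk 1 i = blk 1 j"
      then show "G f i = G f j" using hb[of i j] by (simp add: G_def)
    qed
  qed
  moreover have "inj_on G (F p)"
  proof (rule inj_onI)
    fix f g assume f: "f \<in> F p" and g: "g \<in> F p" and eq: "G f = G g"
    have fA: "f \<in> A \<rightarrow>\<^sub>E A" and gA: "g \<in> A \<rightarrow>\<^sub>E A"
      using f g unfolding F_def mem_Collect_eq by simp_all
    define d where "d j = f j - g j" for j
    define D where "D = (\<Sum>j\<in>A. Poly_Mapping.single j (d j))"
    define T where "T = set_elem (blk 1 i)"
    have DQ: "resid_coeff p (D * Q) l = (\<Sum>j\<in>A. d j * resid_coeff p Q (l - j))" for Q l
      unfolding D_def by (rule resid_coeff_sum_single_mult)
    have "p dvd resid_coeff p (D * T) l" for l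
    proof -
      have "l mod p \<in> A" by (simp add: A_def)
      then have "h f (l mod p) mod p = h g (l mod p) mod p"
        using fun_cong[OF eq, of "l mod p"] by (simp add: G_def)
      then have "p dvd h f (l mod p) - h g (l mod p)" by (simp add: mod_eq_dvd_iff)
      also have "h f (l mod p) - h g (l mod p) = resid_coeff p (D * T) (l mod p)"
        by (simp add: DQ T_def resid_coeff_blk h_def d_def left_diff_distrib sum_subtractf)
      also have "\<dots> = resid_coeff p (D * T) l"
        by (rule resid_coeff_cong) (simp add: mod_eq_dvd_iff[symmetric])
      finally show ?thesis .
    qed
    \<comment> \<open>The additional factor completes \<open>T\<close> to \<open>T ^ nat p\<close>,
      which modulo \<open>p\<close> is the scalar \<open>card (blk 1 i)\<close>.\<close>
    then have "p dvd resid_coeff p (T ^ (nat p - 1) * (D * T)) l" for l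
      unfolding T_def by (rule dvd_resid_coeff_power_mult)
    moreover have "T ^ (nat p - 1) * (D * T) = D * T ^ nat p"
      using p_gt_1 by (simp add: power_eq_if[of T "nat p"] mult_ac)
    ultimately have dvd1: "p dvd (\<Sum>j\<in>A. d j * resid_coeff p (T ^ nat p) (l - j))" for l
      by (simp only: DQ)
    have pp: "p dvd resid_coeff p (T ^ nat p) l - int (card (blk 1 i)) * of_bool (p dvd l)" for l
    proof -
      have "p dvd p * x - l \<longleftrightarrow> p dvd l" for x by (rule dvd_diff_right_iff) simp
      then have "{x \<in> blk 1 i. p dvd p * x - l} = (if p dvd l then blk 1 i else {})" by simp
      moreover have "Factorial_Ring.prime (nat p)" using prime_int_nat_transfer[of p] prime_p by blast
      from resid_coeff_prime_power[OF this finite_blk, of p 1 i l]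
      have "p dvd resid_coeff p (T ^ nat p) l - int (card {x \<in> blk 1 i. p dvd p * x - l})"
        by (simp add: T_def)
      ultimately show ?thesis by (auto split: if_splits)
    qed
    \<comment> \<open>Now \<open>p\<close> divides \<open>d l\<close> times the block size. The
      block size lies strictly between 0 and \<open>p\<close>, and \<open>d l\<close> is a
      difference of two residues in \<open>A\<close>.\<close>
    have "d l = 0" if l: "l \<in> A" for l
    proof -
      have lj: "p dvd l - j \<longleftrightarrow> j = l" if "j \<in> A" for j
      proof -
        have "p dvd l - j \<longleftrightarrow> l mod p = j mod p" by (rule mod_eq_dvd_iff[symmetric])
        moreover have "l mod p = l" "j mod p = j" using l that by (simp_all add: A_def)
        ultimately show ?thesis by auto
      qed
      have "p dvd (\<Sum>j\<in>A. d j * (resid_coeff p (T ^ nat p) (l - j)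
          - int (card (blk 1 i)) * of_bool (p dvd l - j)))"
        using pp by (intro dvd_sum dvd_mult) auto
      from dvd_diff[OF dvd1[of l] this]
      have "p dvd (\<Sum>j\<in>A. d j * (int (card (blk 1 i)) * of_bool (p dvd l - j)))"
        by (simp add: sum_subtractf[symmetric] right_diff_distrib)
      also have "(\<Sum>j\<in>A. d j * (int (card (blk 1 i)) * of_bool (p dvd l - j)))
        = (\<Sum>j\<in>A. if j = l then d l * int (card (blk 1 i)) else 0)"
        by (rule sum.cong[OF refl]) (simp add: lj)
      also have "\<dots> = d l * int (card (blk 1 i))" using l finA by simp
      finally have "p dvd d l \<or> p dvd int (card (blk 1 i))"
        using prime_p by (simp add: prime_dvd_mult_iff)
      moreover have "card (blk 1 i) > 0" using blk_self[of i 1] by (auto simp: card_gt_0_iff)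
      then have "\<not> p dvd int (card (blk 1 i))" using T zdvd_not_zless[of "int (card (blk 1 i))" p] by auto
      moreover have "f l \<in> A" "g l \<in> A" using PiE_mem[OF fA l] PiE_mem[OF gA l] .
      then have "\<bar>d l\<bar> < p" by (auto simp: d_def A_def)
      ultimately show "d l = 0" using zdvd_imp_le[of p "\<bar>d l\<bar>"] by (cases "d l = 0") auto
    qed
    then have "f l = g l" if "l \<in> A" for l using that by (simp add: d_def)
    moreover have "f \<in> extensional A" "g \<in> extensional A" using fA gA by (simp_all add: PiE_def)
    ultimately show "f = g" by (intro extensionalityI[of f A g]) auto
  qed
  ultimately have "card (F p) \<le> card (F 1)"
    by (intro card_inj_on_le[of G "F p" "F 1"] image_subsetI finF)
  then show ?thesis using p_gt_1 by (simp add: cardF)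
qed

text \<open>Otherwise every block of degree 1 has size at least \<open>max 2 bsize\<close>, and
  there are at least as many blocks as in degree \<open>p\<close>, namely
  \<open>1 + (p - 1) / bsize\<close>. Degree 1 would then hold more than \<open>p\<close>
  residues.\<close>

lemma total_or_singleton:
  assumes "Factorial_Ring.prime (q::nat)" "card K = q ^ k"
  shows "(\<forall>i j. E 1 i 1 j) \<or> (\<exists>t. \<forall>j. E 1 t 1 j \<longrightarrow> p dvd j - t)"
proof (rule ccontr)
  assume contra: "\<not> ?thesis"
  then obtain i j where ij: "\<not> E 1 i 1 j" by blast
  then have "j mod p \<notin> blk 1 i" by (simp add: mem_blk_iff)
  moreover have "j mod p \<in> {0..<p}" by simp
  moreover have "blk 1 i \<subseteq> {0..<p}" by (auto simp: mem_blk_iff)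
  ultimately have "blk 1 i \<subset> {0..<p}" by blast
  then have "card (blk 1 i) < card {0..<p}" by (intro psubset_card_mono) auto
  then have le: "card (blocks p) \<le> card (blocks 1)" by (intro card_blocks_le) simp
  obtain e where e: "bsize = q ^ e"
    using bsize_dvd_card_K assms by (metis divides_primepow_nat)
  have big: "max 2 bsize \<le> card B" if "B \<in> blocks 1" for B
  proof -
    from that obtain t where B: "B = blk 1 t" unfolding blocks_def by (elim imageE)
    have pos: "card B > 0" using blk_self[of t 1] by (auto simp: B card_gt_0_iff)
    have "card B \<noteq> 1"
    proof
      assume "card B = 1"
      then have sing: "B = {t mod p}" using blk_self[of t 1] unfolding B by (auto simp: card_1_singleton_iff)
      have "p dvd j - t" if "E 1 t 1 j" for j
      proof -
        have "j mod p \<in> B" using that by (simp add: B mem_blk_iff)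
        then show ?thesis using sing by (simp add: mod_eq_dvd_iff)
      qed
      then show False using contra by blast
    qed
    then have two: "card B \<ge> 2" using pos by simp
    \<comment> \<open>Consecutive numbers are coprime and \<open>bsize\<close> is a power of
      \<open>q\<close>, so \<open>bsize\<close> divides one of the two factors; both are positive
      here.\<close>
    have "coprime (card B) (card B - 1)" using pos by (cases "card B") simp_all
    then have "bsize dvd card B \<or> bsize dvd card B - 1"
      using prime_power_dvd_mult_coprime[OF assms(1)] bsize_dvd_card_blk_1[of t] unfolding e B by blast
    then have "bsize \<le> card B" using two dvd_imp_le[of bsize "card B"] dvd_imp_le[of bsize "card B - 1"] by auto
    then show ?thesis using two by simp
  qed
  have "card (blocks p) * max 2 bsize \<le> card (blocks 1) * max 2 bsize" using le by simp
  also have "\<dots> = (\<Sum>B\<in>blocks 1. max 2 bsize)" by simp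
  also have "\<dots> \<le> (\<Sum>B\<in>blocks 1. card B)" by (rule sum_mono) (rule big)
  also have "\<dots> = nat p" by (rule sum_card_blocks)
  finally have bound: "card (blocks p) * max 2 bsize \<le> nat p" .
  obtain c where c: "card (blocks p) = Suc c" using card_blocks_p(2) by (metis Suc_le_D One_nat_def)
  have sc: "bsize * c = nat p - 1" using card_blocks_p(1) c by simp
  have p1: "nat p > 1" using p_gt_1 by simp
  show False
  proof (cases "bsize = 1")
    case True
    then show ?thesis using sc c bound p1 by simp
  next
    case False
    then have "bsize \<ge> 2" using bsize_pos by simp
    then have "Suc c * bsize \<le> nat p" using bound c by (simp add: max_def)
    then show ?thesis using sc p1 \<open>bsize \<ge> 2\<close> by (simp add: mult.commute)
  qed
qed

end

subsection \<open>Automorphisms preserving the classes\<close>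

context schur_classes
begin

text \<open>A pair \<open>(e, h)\<close> with \<open>E p 1 (e * p) h\<close> serves as the linear
  part of a class-preserving automorphism. If \<open>h\<close> vanished, \<open>z^p a\<close> would
  share a class with a power of \<open>z^p\<close>, against \<open>E_sub\<close>.\<close>

lemma valid_unit:
  assumes "E p 1 (e * p) h"
  shows "\<not> p dvd h"
proof
  assume "p dvd h"
  then have "E p 1 (e * p) 0" using assms E_cong[of 1 1 h 0 p "e * p"] by simp
  then have "E (p * e) 0 p 1" using E_sym[of p 1 "p * e" 0] by (simp add: mult.commute)
  then have "p dvd 1" using E_sub by blast
  then show False using p_gt_1 by simp
qed

text \<open>By \<open>drel_neg_self\<close> a sign change in one nonzero degree entails one in every
  degree, in particular in degree \<open>p\<close>.\<close>

lemma valid_exists: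
  assumes "drel n (e * n)" "n \<noteq> 0" "e \<in> {1, -1}"
  obtains h where "E p 1 (e * p) h"
proof -
  have "drel p (e * p)"
  proof (cases "e = 1")
    case False
    then have "e = -1" using assms(3) by simp
    then show ?thesis using assms drel_neg_self[of n p] by simp
  qed simp
  then obtain h where "E p 1 (e * p) h" by (rule drel_E)
  then show ?thesis by (rule that)
qed

text \<open>In degree \<open>p\<close>, multiplying residues by \<open>b\<close> carries 1 to
  \<open>b\<close>, and periodicity then replaces \<open>p\<close> by \<open>a\<close>. In degree 0,
  \<open>h\<close> agrees modulo \<open>p\<close> with a multiplier in \<open>K\<close>.\<close>

lemma valid_act:
  assumes e: "e \<in> {1, -1}" and v: "E p 1 (e * p) h" and a: "p dvd a"
  shows "E a b (e * a) (h * b)"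
proof (cases "a = 0")
  case True
  obtain k where "k \<in> K" "p dvd k * 1 - h" using E_p_imp_E_0[OF v] E_zero by blast
  then have "k \<in> K \<and> p dvd k * b - h * b" using dvd_mult2[of p "k * 1 - h" b] by (simp add: left_diff_distrib)
  then show ?thesis using True E_zero by auto
next
  case False
  have "E (1 * p) b (e * p) (h * b)"
  proof (cases "p dvd b")
    case True
    have "drel p (e * p)" using v by (auto simp: drel_def)
    then obtain j where j: "E p 0 (e * p) j" by (rule drel_E)
    then have "p dvd j" using E_sub[of 1 "e * p" j] by simp
    then show ?thesis using j True E_cong[of b 0 "h * b" j p "e * p"] by simp
  next
    case b: False
    have "E (1 * p) (b * 1) (e * p) (b * h)" using E_p_mult_iff[OF b, of 1 e 1 h] e v by simp
    then show ?thesis by (simp add: mult.commute)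
  qed
  then show ?thesis using E_cong_degree[of p a 1 e b "h * b"] e a False by simp
qed

text \<open>Dividing by a unit \<open>i\<close> normalizes the first residue to 1. If
  \<open>p\<close> divides \<open>i\<close>, it also divides \<open>j\<close>, and any
  \<open>h\<close> available for the sign \<open>e\<close> will do.\<close>

lemma valid_of_E_p:
  assumes E: "E p i (e * p) j" and e: "e \<in> {1, -1}"
  obtains h where "E p 1 (e * p) h" "p dvd h * i - j"
proof (cases "p dvd i")
  case True
  have "drel p (e * p)" using E by (auto simp: drel_def)
  then obtain h where h: "E p 1 (e * p) h" by (rule drel_E)
  have "E (p * 1) 0 (e * p) j" using E True E_cong[of i 0 j j p "e * p"] by simp
  then have "p dvd j" using E_sub by blast
  then have "p dvd h * i - j" using True by simp
  then show ?thesis using that h by blast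
next
  case False
  obtain k where k: "\<not> p dvd k" "p dvd k * i - 1"
    using exists_inverse_mod_prime[OF prime_p False] by metis
  have "E (1 * p) (k * i) (e * p) (k * j)" using E_p_mult_iff[OF k(1), of 1 e i j] e E by simp
  then have v: "E p 1 (e * p) (k * j)" using E_cong[of "k * i" 1 "k * j" "k * j" p "e * p"] k(2) by simp
  have "k * j * i - j = (k * i - 1) * j" by (simp add: algebra_simps)
  then have "p dvd k * j * i - j" using dvd_mult2[OF k(2), of j] by (simp only:)
  then show ?thesis using that v by blast
qed

text \<open>A point needs one residue in degree 1 and one in degree -1. If the class reaches degree
  -1, its slice there also has size 1; otherwise the class of the inverse supplies the second
  residue.\<close>

lemma singleton_imp_point:
  assumes sing: "\<And>j. E 1 t 1 j \<Longrightarrow> p dvd j - t"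
  shows "\<exists>s. point 1 s"
proof -
  have E1: "E 1 t 1 y \<longleftrightarrow> p dvd y - t" for y
    using sing[of y] E_refl[of t y 1] by (auto simp: dvd_diff_commute[of p t y])
  show ?thesis
  proof (cases "drel 1 (- 1)")
    case True
    then obtain u where u: "E 1 t (- 1) u" by (rule drel_E)
    have "slice 1 t 1 = {t mod p}"
    proof -
      have "y = t mod p" if "y \<in> slice 1 t 1" for y
        using that E1[of y] mod_eq_dvd_iff[of y p t] by (auto simp: slice_def)
      moreover have "t mod p \<in> slice 1 t 1" by (simp add: slice_def)
      ultimately show ?thesis by blast
    qed
    then have "card (slice 1 t (- 1)) = 1" using card_slice_drel[OF True, of 1 t] by simp
    then obtain v where v: "slice 1 t (- 1) = {v}" by (auto simp: card_1_singleton_iff)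
    have "E 1 t (- 1) y \<longleftrightarrow> y mod p \<in> slice 1 t (- 1)" for y
      by (simp add: slice_def)
    then have mem: "E 1 t (- 1) y \<longleftrightarrow> y mod p = v" for y unfolding v by simp
    then have "u mod p = v" using u by simp
    then have E2: "E 1 t (- 1) y \<longleftrightarrow> p dvd y - u" for y
      using mem[of y] by (simp only: mod_eq_dvd_iff[symmetric])
    let ?s = "\<lambda>e::int. if e = 1 then t else u"
    have "\<forall>e\<in>{1, -1}. \<forall>y. of_bool (E 1 t (e * 1) y) = (of_bool (p dvd y - ?s e) :: int)"
      by (simp add: E1 E2)
    then have "point 1 ?s" unfolding point_def using class_fun_indicator by blast
    then show ?thesis by blast
  next
    case False
    have no: "\<not> E 1 t (- 1) y" "\<not> E (- 1) (- t) 1 y" for y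
      using False drel_sym[of "-1" 1] by (auto simp: drel_def)
    have E2: "E (- 1) (- t) (- 1) y \<longleftrightarrow> p dvd y + t" for y
    proof -
      have "E (- 1) (- t) (- 1) y \<longleftrightarrow> p dvd - y - t" using E_neg_iff[of 1 t 1 "- y"] E1[of "- y"] by simp
      also have "- y - t = - (y + t)" by simp
      finally show ?thesis by (simp only: dvd_minus_iff)
    qed
    let ?f = "\<lambda>m j. of_bool (E 1 t m j) + of_bool (E (- 1) (- t) m j) :: int"
    have "class_fun ?f"
      using class_fun_indicator[of 1 t] class_fun_indicator[of "-1" "-t"] unfolding class_fun_def by metis
    moreover have "\<forall>e\<in>{1, -1}. \<forall>y. ?f (e * 1) y = of_bool (p dvd y - e * t)"
      by (simp add: E1 E2 no)
    ultimately have "point 1 (\<lambda>e. e * t)" unfolding point_def by blast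
    then show ?thesis by blast
  qed
qed

lemma point_multiple:
  assumes pt: "point 1 t" and "n \<noteq> 0"
  shows "point n (\<lambda>e. n * t e)"
proof -
  have pos: "point (int k) (\<lambda>e. int k * t e)" if "k \<ge> 1" for k
    using that
  proof (induction k rule: dec_induct)
    case base
    then show ?case using pt by simp
  next
    case (step k)
    have "int k \<noteq> 0" "int k + 1 \<noteq> 0" using step.hyps by auto
    then have "point (int k + 1) (\<lambda>e. int k * t e + t e)"
      by (intro point_add[OF step.IH pt]) auto
    then show ?case by (simp add: algebra_simps)
  qed
  show ?thesis
  proof (cases "n > 0")
    case True
    then show ?thesis using pos[of "nat n"] by simp
  next
    case False
    then have "point (- n) (\<lambda>e. - n * t e)" using pos[of "nat (- n)"] \<open>n \<noteq> 0\<close> by simp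
    from point_neg[OF this] show ?thesis by simp
  qed
qed

text \<open>A point of degree 1 straightens the coordinates: after translation by its
  \<open>n\<close>-th power, degree \<open>n\<close> carries the same relation as degree
  \<open>p\<close>.\<close>

lemma E_iff_E_p:
  assumes pt: "point 1 t" and n: "n \<noteq> 0" and e: "e \<in> {1, -1}" "e' \<in> {1, -1}"
  shows "E (e * n) i (e' * n) j \<longleftrightarrow> E (e * p) (i - n * t e) (e' * p) (j - n * t e')"
proof -
  \<comment> \<open>Translations must avoid degree 0; \<open>m = p\<close> does so unless
    \<open>n = - p\<close>.\<close>
  obtain m where m: "m \<noteq> 0" "p dvd m" "m + n \<noteq> 0"
  proof (cases "n = - p")
    case True
    then have "2 * p \<noteq> 0" "p dvd 2 * p" "2 * p + n \<noteq> 0" by auto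
    then show ?thesis by (rule that)
  next
    case False
    then have "p \<noteq> 0" "p dvd p" "p + n \<noteq> 0" by auto
    then show ?thesis by (rule that)
  qed
  have mn: "E (e * n) x (e' * n) y \<longleftrightarrow> E (e * (m + n)) x (e' * (m + n)) y" for x y
    by (rule E_cong_degree[OF n m(3) _ e]) (use m(2) in simp)
  have mp: "E (e * p) x (e' * p) y \<longleftrightarrow> E (e * m) x (e' * m) y" for x y
    by (rule E_cong_degree[OF p_pos(2) m(1) _ e]) (use m(2) in simp)
  show ?thesis
  proof
    assume "E (e * n) i (e' * n) j"
    then have "E (e * (m + n)) i (e' * (m + n)) j" by (simp only: mn)
    from point_translate[OF point_multiple[OF pt n] m(1) n m(3) e this]
    show "E (e * p) (i - n * t e) (e' * p) (j - n * t e')" by (simp only: mp)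
  next
    assume "E (e * p) (i - n * t e) (e' * p) (j - n * t e')"
    then have "E (e * (m + n + - n)) (i - n * t e) (e' * (m + n + - n)) (j - n * t e')"
      by (simp add: mp)
    \<comment> \<open>The way back starts in degree \<open>m\<close>, written as
      \<open>(m + n) + (- n)\<close>, and uses the inverse point of degree
      \<open>- n\<close>.\<close>
    from point_translate[OF point_neg[OF point_multiple[OF pt n]] m(3) _ _ e this]
    have "E (e * (m + n)) i (e' * (m + n)) j" using n m(1) by simp
    then show "E (e * n) i (e' * n) j" by (simp only: mn)
  qed
qed

section \<open>Extending a linear part to all degrees\<close>

lemma total_degree:
  assumes tot: "\<And>i j. E 1 i 1 j" and n: "\<not> p dvd n"
  shows "E n i n j"
proof -
  define k where "k = n mod p"
  have "k \<ge> 0" "\<not> p dvd k" using n by (auto simp: k_def dvd_mod_iff)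
  then have k: "k > 0" "\<not> p dvd k" by (cases "k = 0"; auto)+
  obtain k' where k': "p dvd k' * k - 1" using exists_inverse_mod_prime[OF prime_p k(2)] by metis
  have c: "p dvd x - k * (k' * x)" for x
  proof -
    have "x - k * (k' * x) = (k' * k - 1) * - x" by (simp add: algebra_simps)
    then show ?thesis using dvd_mult2[OF k'] by metis
  qed
  have "E (1 * (k * 1)) (k * (k' * i)) (1 * (k * 1)) (k * (k' * j))"
    using E_mult_iff[OF k, of 1 1 1 "k' * i" "k' * j"] tot by simp
  then have "E (1 * k) i (1 * k) j" using E_cong[OF c[of i] c[of j], of k k] by simp
  moreover have "n \<noteq> 0" "p dvd k - n" using n by (auto simp: k_def mod_eq_dvd_iff[symmetric])
  ultimately show ?thesis using E_cong_degree[of k n 1 1 i j] k(1) by simp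
qed

text \<open>Each degree prime to \<open>p\<close> is a single block, so any \<open>c\<close> is
  allowed there; in the other degrees \<open>c * a\<close> vanishes modulo \<open>p\<close>.\<close>

lemma total_extension:
  assumes tot: "\<And>i j. E 1 i 1 j" and e: "e \<in> {1, -1}" and v: "E p 1 (e * p) h"
  shows "E a b (e * a) (h * b + c * a)"
proof (cases "p dvd a")
  case True
  then have "p dvd h * b - (h * b + c * a)" by simp
  then show ?thesis using valid_act[OF e v True, of b] E_cong[of b b "h * b" "h * b + c * a"] by simp
next
  case False
  have "drel p (e * p)" using v by (auto simp: drel_def)
  have "drel a (e * a)"
  proof (cases "e = 1")
    case False
    then have "e = -1" using e by simp
    then show ?thesis using \<open>drel p (e * p)\<close> drel_neg_self[of p a] by simp
  qed simp
  then obtain y where y: "E a b (e * a) y" by (rule drel_E)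
  have "\<not> p dvd e * a" using False e by auto
  from E_trans[OF y total_degree[OF tot this]] show ?thesis .
qed

text \<open>The constant \<open>t e - h * t 1\<close> is the one that sends \<open>z a^(t 1)\<close>
  to \<open>z^e a^(t e)\<close>; in straightened coordinates the map is multiplication by
  \<open>h\<close>.\<close>

lemma point_extension:
  assumes pt: "point 1 t" and e: "e \<in> {1, -1}" and v: "E p 1 (e * p) h"
  shows "E a b (e * a) (h * b + (t e - h * t 1) * a)"
proof (cases "a = 0")
  case True
  then show ?thesis using valid_act[OF e v, of 0 b] by simp
next
  case False
  have "E p (b - a * t 1) (e * p) (h * (b - a * t 1))" by (rule valid_act[OF e v]) simp
  moreover have "h * (b - a * t 1) = h * b + (t e - h * t 1) * a - a * t e"
    by (simp add: algebra_simps)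
  ultimately have "E (1 * p) (b - a * t 1) (e * p) (h * b + (t e - h * t 1) * a - a * t e)" by simp
  then show ?thesis
    using E_iff_E_p[OF pt False, of 1 e b "h * b + (t e - h * t 1) * a"] e by simp
qed

text \<open>The linear part is found in degree \<open>p\<close>. If degree 1 is a single block,
  \<open>c\<close> is free and can be solved for in degrees prime to \<open>p\<close>; with a point,
  \<open>c\<close> is determined and the straightened coordinates provide \<open>h\<close>.\<close>

lemma transitive_on_classes:
  assumes q: "Factorial_Ring.prime (q::nat)" "card K = q ^ r" and E: "E n i n' j"
  obtains e h c where "\<not> p dvd h" "e \<in> {1, -1}" "\<And>a b. E a b (e * a) (h * b + c * a)"
    "n' = e * n" "p dvd h * i + c * n - j"
proof -
  note result = that
  have goal: thesis if v: "E p 1 (e * p) h" and "e \<in> {1, -1}" "\<And>a b. E a b (e * a) (h * b + c * a)"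
    "n' = e * n" "p dvd h * i + c * n - j" for e h c
    using valid_unit[OF v] that(2-5) by (rule result)
  have n': "n \<noteq> 0 \<Longrightarrow> \<exists>e\<in>{1, -1}. n' = e * n" using E_deg[OF E] by auto
  \<comment> \<open>A multiplier \<open>k\<close> of degree 0 lifts to degree \<open>p\<close> with
    some sign \<open>e\<close>; any sign is acceptable because \<open>e * 0 = 0\<close>.\<close>
  have zero: "\<exists>e\<in>{1, -1}. \<exists>h. E p 1 (e * p) h \<and> n' = e * n \<and> p dvd h * i - j" if n0: "n = 0"
  proof -
    have E0: "E 0 i n' j" using E n0 by simp
    then obtain k where k: "n' = 0" "k \<in> K" "p dvd k * i - j" using E_zero by blast
    have "p dvd k * 1 - k" by simp
    then have "E 0 1 0 k" using E_zero k(2) by blast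
    then obtain e where "e \<in> {1, -1}" "E p 1 (e * p) k" using E_0_imp_E_p by blast
    then show ?thesis using k n0 by auto
  qed
  consider (total) "\<And>i j. E 1 i 1 j" | (point) t where "point 1 t"
    using total_or_singleton[OF q] singleton_imp_point by blast
  then show thesis
  proof cases
    case total
    consider "n = 0" | "n \<noteq> 0" "p dvd n" | "\<not> p dvd n" by blast
    then show thesis
    proof cases
      case 1
      then obtain e h where eh: "e \<in> {1, -1}" "E p 1 (e * p) h" "n' = e * n" "p dvd h * i - j"
        using zero by blast
      show thesis
        by (rule goal[OF eh(2,1) total_extension[OF total eh(1,2)] eh(3), where c = 0]) (use eh(4) in simp)
    next
      case 2
      then obtain e where e: "e \<in> {1, -1}" "n' = e * n" using n' by blast
      then have "E (1 * p) i (e * p) j"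
        using E E_cong_degree[of n p 1 e i j] 2 by simp
      then obtain h where h: "E p 1 (e * p) h" "p dvd h * i - j"
        using valid_of_E_p[of i e j] e(1) by auto
      show thesis
        by (rule goal[OF h(1) e(1) total_extension[OF total e(1) h(1)] e(2), where c = 0]) (use h(2) in simp)
    next
      case 3
      then have n0: "n \<noteq> 0" by auto
      then obtain e where e: "e \<in> {1, -1}" "n' = e * n" using n' by blast
      have "drel n (e * n)" using E e(2) by (auto simp: drel_def)
      then obtain h where h: "E p 1 (e * p) h" using valid_exists n0 e(1) by blast
      \<comment> \<open>As \<open>k\<close> inverts \<open>n\<close> modulo \<open>p\<close>, the
        choice \<open>c = k * (j - h * i)\<close> takes the residue \<open>i\<close> to
        \<open>j\<close>.\<close>
      obtain k where k: "p dvd k * n - 1" using exists_inverse_mod_prime[OF prime_p 3] by metis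
      have "h * i + (k * (j - h * i)) * n - j = (k * n - 1) * (j - h * i)" by (simp add: algebra_simps)
      then have "p dvd h * i + (k * (j - h * i)) * n - j" using dvd_mult2[OF k] by metis
      then show thesis by (rule goal[OF h(1) e(1) total_extension[OF total e(1) h(1)] e(2)])
    qed
  next
    case point
    show thesis
    proof (cases "n = 0")
      case True
      then obtain e h where eh: "e \<in> {1, -1}" "E p 1 (e * p) h" "n' = e * n" "p dvd h * i - j"
        using zero by blast
      show thesis
        by (rule goal[OF eh(2,1) point_extension[OF point eh(1,2)] eh(3)]) (use eh(4) True in simp)
    next
      case False
      then obtain e where e: "e \<in> {1, -1}" "n' = e * n" using n' by blast
      have "E (1 * n) i (e * n) j" using E e(2) by simp
      then have "E p (i - n * t 1) (e * p) (j - n * t e)"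
        using E_iff_E_p[OF point False, of 1 e i j] e(1) by simp
      then obtain h where h: "E p 1 (e * p) h" "p dvd h * (i - n * t 1) - (j - n * t e)"
        using valid_of_E_p e(1) by blast
      have "h * (i - n * t 1) - (j - n * t e) = h * i + (t e - h * t 1) * n - j"
        by (simp add: algebra_simps)
      then have "p dvd h * i + (t e - h * t 1) * n - j" using h(2) by (simp only:)
      then show thesis by (rule goal[OF h(1) e(1) point_extension[OF point e(1) h(1)] e(2)])
    qed
  qed
qed

end

subsection \<open>Automorphisms of the two groups\<close>

lemma group_Zp:
  assumes "P > 0"
  shows "group (Zp P)"
proof (rule groupI)
  fix x assume x: "x \<in> carrier (Zp P)"
  then show "\<exists>y\<in>carrier (Zp P). y \<otimes>\<^bsub>Zp P\<^esub> x = \<one>\<^bsub>Zp P\<^esub>"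
    using assms by (intro bexI[of _ "(- x) mod P"]) (auto simp: Zp_def mod_simps)
qed (use assms in \<open>auto simp: Zp_def mod_simps algebra_simps\<close>)

lemma group_Gp:
  assumes "P > 0"
  shows "group (Gp P)"
proof (rule groupI)
  fix x assume x: "x \<in> carrier (Gp P)"
  then show "\<exists>y\<in>carrier (Gp P). y \<otimes>\<^bsub>Gp P\<^esub> x = \<one>\<^bsub>Gp P\<^esub>"
    using assms by (intro bexI[of _ "(- fst x, (- snd x) mod P)"]) (auto simp: Gp_def mod_simps)
qed (use assms in \<open>auto simp: Gp_def mod_simps algebra_simps\<close>)

lemma inv_Gp:
  assumes "P > 0" "j \<in> {0..<P}"
  shows "inv\<^bsub>Gp P\<^esub> (n, j) = (- n, (- j) mod P)"
  using group_Gp[OF assms(1)] assms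
  by (intro group.inv_equality) (auto simp: Gp_def mod_simps)

lemma mult_AutoGroup:
  assumes "f \<in> auto G" "g \<in> auto G"
  shows "f \<otimes>\<^bsub>AutoGroup G\<^esub> g = compose (carrier G) f g"
  using assms by (simp add: AutoGroup_def BijGroup_def auto_def)

lemma carrier_AutoGroup [simp]: "carrier (AutoGroup G) = auto G"
  by (simp add: AutoGroup_def)

lemma one_AutoGroup: "\<one>\<^bsub>AutoGroup G\<^esub> = (\<lambda>x\<in>carrier G. x)"
  by (simp add: AutoGroup_def BijGroup_def)

lemma (in group) inv_AutoGroup_apply:
  assumes "f \<in> auto G" "x \<in> carrier G"
  shows "(inv\<^bsub>AutoGroup G\<^esub> f) (f x) = x" "f ((inv\<^bsub>AutoGroup G\<^esub> f) x) = x"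
    "(inv\<^bsub>AutoGroup G\<^esub> f) x \<in> carrier G"
proof -
  interpret A: group "AutoGroup G" by (rule AutoGroup)
  have inv: "inv\<^bsub>AutoGroup G\<^esub> f \<in> auto G" using A.inv_closed[of f] assms(1) by simp
  have "compose (carrier G) (inv\<^bsub>AutoGroup G\<^esub> f) f = (\<lambda>x\<in>carrier G. x)"
    using A.l_inv[of f] assms(1) inv by (simp add: mult_AutoGroup one_AutoGroup)
  from fun_cong[OF this, of x] show "(inv\<^bsub>AutoGroup G\<^esub> f) (f x) = x"
    using assms(2) by (simp add: compose_def)
  have "compose (carrier G) f (inv\<^bsub>AutoGroup G\<^esub> f) = (\<lambda>x\<in>carrier G. x)"
    using A.r_inv[of f] assms(1) inv by (simp add: mult_AutoGroup one_AutoGroup)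
  from fun_cong[OF this, of x] show "f ((inv\<^bsub>AutoGroup G\<^esub> f) x) = x"
    using assms(2) by (simp add: compose_def)
  show "(inv\<^bsub>AutoGroup G\<^esub> f) x \<in> carrier G"
    using inv assms(2) by (auto simp: auto_def hom_def)
qed

lemma auto_Zp_apply:
  assumes f: "f \<in> auto (Zp P)" and P: "P > 1" and i: "i \<in> {0..<P}"
  shows "f i = (f 1 * i) mod P"
proof -
  have hom: "f ((x + y) mod P) = (f x + f y) mod P" if "x \<in> {0..<P}" "y \<in> {0..<P}" for x y
    using f that by (auto simp: auto_def hom_def Zp_def)
  have car: "f x \<in> {0..<P}" if "x \<in> {0..<P}" for x
    using f that by (auto simp: auto_def hom_def Zp_def)
  have "int k < P \<Longrightarrow> f (int k) = (f 1 * int k) mod P" for k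
  proof (induction k)
    case 0
    have "f 0 = (f 0 + f 0) mod P" using hom[of 0 0] P by simp
    then have "f 0 mod P = (f 0 + f 0) mod P" using car[of 0] P by simp
    then have "P dvd f 0" by (simp add: mod_eq_dvd_iff)
    then show ?case using car[of 0] P zdvd_not_zless[of "f 0" P] by (cases "f 0 = 0") auto
  next
    case (Suc k)
    then have "f (int k) = (f 1 * int k) mod P" by simp
    moreover have "f (int k + 1) = (f (int k) + f 1) mod P"
      using hom[of "int k" 1] Suc.prems P by simp
    ultimately show ?case by (simp add: mod_simps algebra_simps)
  qed
  from this[of "nat i"] show ?thesis using i by simp
qed

lemma affine_auto_Gp:
  assumes P: "Factorial_Ring.prime P" and e: "e \<in> {1, -1}" and h: "\<not> P dvd h"
  shows "(\<lambda>x\<in>carrier (Gp P). (e * fst x, (h * snd x + c * fst x) mod P)) \<in> auto (Gp P)"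
proof -
  have P1: "P > 1" using P by (simp add: prime_gt_1_int)
  obtain k where k: "P dvd k * h - 1" using exists_inverse_mod_prime[OF P h] by metis
  have ee: "e * e = 1" using e by auto
  let ?f = "\<lambda>x\<in>carrier (Gp P). (e * fst x, (h * snd x + c * fst x) mod P)"
  \<comment> \<open>The inverse map: \<open>e\<close> is its own inverse, and \<open>k\<close>
    inverts \<open>h\<close> modulo \<open>P\<close>.\<close>
  let ?g = "\<lambda>x. (e * fst x, (k * (snd x - c * e * fst x)) mod P)"
  have r1: "(k * (h * b)) mod P = b" if "b \<in> {0..<P}" for b
  proof -
    have "P dvd (k * h - 1) * b" using k by simp
    then have "P dvd k * (h * b) - b" by (simp add: algebra_simps)
    then have "(k * (h * b)) mod P = b mod P" by (simp add: mod_eq_dvd_iff)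
    then show ?thesis using that by simp
  qed
  have r2: "(h * (k * b)) mod P = b mod P" for b
  proof -
    have "P dvd (k * h - 1) * b" using k by simp
    then have "P dvd h * (k * b) - b" by (simp add: algebra_simps)
    then show ?thesis by (simp add: mod_eq_dvd_iff)
  qed
  have "bij_betw ?f (carrier (Gp P)) (carrier (Gp P))"
  proof (rule bij_betwI[where g = ?g])
    show "?f \<in> carrier (Gp P) \<rightarrow> carrier (Gp P)" "?g \<in> carrier (Gp P) \<rightarrow> carrier (Gp P)"
      using P1 by (auto simp: Gp_def)
    fix x assume x: "x \<in> carrier (Gp P)"
    obtain a b where ab: "x = (a, b)" by force
    have b: "b \<in> {0..<P}" using x ab by (simp add: Gp_def)
    have "e * (e * a) = a" using ee by (simp flip: mult.assoc)
    moreover have "(k * ((h * b + c * a) mod P - c * e * (e * a))) mod P = b"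
    proof -
      have "(k * ((h * b + c * a) mod P - c * e * (e * a))) mod P
        = (k * ((h * b + c * a) - c * e * (e * a))) mod P"
        by (metis mod_diff_left_eq mod_mult_right_eq)
      also have "(h * b + c * a) - c * e * (e * a) = h * b"
        using ee by (simp add: mult.assoc)
      finally show ?thesis using r1[OF b] by simp
    qed
    ultimately show "?g (?f x) = x" using x by (simp add: ab)
    have "(h * ((k * (b - c * e * a)) mod P) + c * (e * a)) mod P = b"
    proof -
      have "(h * ((k * (b - c * e * a)) mod P) + c * (e * a)) mod P
        = ((h * (k * (b - c * e * a))) mod P + c * (e * a)) mod P"
        by (metis mod_add_left_eq mod_mult_right_eq)
      also have "\<dots> = ((b - c * e * a) + c * (e * a)) mod P" unfolding r2 by (rule mod_add_left_eq)
      also have "\<dots> = b" using b by (simp add: mult.assoc)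
      finally show ?thesis .
    qed
    moreover have "?g x \<in> carrier (Gp P)" using P1 by (simp add: Gp_def)
    ultimately show "?f (?g x) = x" using \<open>e * (e * a) = a\<close> by (simp add: ab)
  qed
  moreover have "?f \<in> hom (Gp P) (Gp P)"
  proof (rule homI)
    show "?f x \<in> carrier (Gp P)" if "x \<in> carrier (Gp P)" for x using P1 that by (auto simp: Gp_def)
    fix x y assume xy: "x \<in> carrier (Gp P)" "y \<in> carrier (Gp P)"
    then have "x \<otimes>\<^bsub>Gp P\<^esub> y \<in> carrier (Gp P)" using P1 by (simp add: Gp_def)
    then show "?f (x \<otimes>\<^bsub>Gp P\<^esub> y) = ?f x \<otimes>\<^bsub>Gp P\<^esub> ?f y"
    proof -
      have "(h * ((i + j) mod P) + c * (a + b)) mod P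
        = ((h * i + c * a) mod P + (h * j + c * b) mod P) mod P" for i j a b
      proof -
        have "(h * ((i + j) mod P) + c * (a + b)) mod P = (h * (i + j) + c * (a + b)) mod P"
          by (metis mod_add_left_eq mod_mult_right_eq)
        also have "h * (i + j) + c * (a + b) = (h * i + c * a) + (h * j + c * b)"
          by (simp add: algebra_simps)
        finally show ?thesis by (simp only: mod_add_eq)
      qed
      then show ?thesis using xy \<open>x \<otimes>\<^bsub>Gp P\<^esub> y \<in> carrier (Gp P)\<close>
        by (simp add: Gp_def distrib_left[of e])
    qed
  qed
  ultimately show ?thesis by (simp add: auto_def Bij_def)
qed

text \<open>\<open>z\<close> and \<open>a\<close> generate the group. This serves to show that only
  finitely many automorphisms preserve the classes.\<close>

lemma auto_Gp_eqI:
  assumes P: "P > 1" and f: "f \<in> auto (Gp P)" and g: "g \<in> auto (Gp P)"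
    and gen: "f (1, 0) = g (1, 0)" "f (0, 1) = g (0, 1)"
  shows "f = g"
proof -
  interpret G: group "Gp P" using P by (intro group_Gp) simp
  interpret f: group_hom "Gp P" "Gp P" f using f by unfold_locales (simp add: auto_def)
  interpret g: group_hom "Gp P" "Gp P" g using g by unfold_locales (simp add: auto_def)
  have car: "(n, i) \<in> carrier (Gp P) \<longleftrightarrow> i \<in> {0..<P}" for n i by (simp add: Gp_def)
  have mult: "f (x \<otimes>\<^bsub>Gp P\<^esub> y) = g (x \<otimes>\<^bsub>Gp P\<^esub> y)"
    if "x \<in> carrier (Gp P)" "y \<in> carrier (Gp P)" "f x = g x" "f y = g y" for x y
    using that by simp
  have pos: "f (int k, 0) = g (int k, 0)" for k
  proof (induction k)
    case 0
    have "f (\<one>\<^bsub>Gp P\<^esub>) = g (\<one>\<^bsub>Gp P\<^esub>)" by simp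
    then show ?case by (simp add: Gp_def)
  next
    case (Suc k)
    have "(int (Suc k), 0) = (1, 0) \<otimes>\<^bsub>Gp P\<^esub> (int k, 0)" by (simp add: Gp_def)
    then show ?case using mult[of "(1, 0)" "(int k, 0)"] Suc gen(1) P by (simp add: car)
  qed
  have neg: "f (- int k, 0) = g (- int k, 0)" for k
  proof -
    have "(- int k, 0) = inv\<^bsub>Gp P\<^esub> (int k, 0)" using P by (simp add: inv_Gp)
    then show ?thesis using pos[of k] P by (simp add: car)
  qed
  have fst: "f (n, 0) = g (n, 0)" for n
    using pos[of "nat n"] neg[of "nat (- n)"] by (cases "n \<ge> 0") auto
  have snd: "int k < P \<Longrightarrow> f (0, int k) = g (0, int k)" for k
  proof (induction k)
    case 0
    then show ?case using fst[of 0] by simp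
  next
    case (Suc k)
    have "(0, int (Suc k)) = (0, 1) \<otimes>\<^bsub>Gp P\<^esub> (0, int k)" using Suc.prems by (simp add: Gp_def)
    then show ?case using mult[of "(0, 1)" "(0, int k)"] Suc gen(2) P by (simp add: car)
  qed
  show ?thesis
  proof (rule extensionalityI)
    show "f \<in> extensional (carrier (Gp P))" "g \<in> extensional (carrier (Gp P))"
      using f g by (auto simp: auto_def Bij_def)
    fix x assume x: "x \<in> carrier (Gp P)"
    obtain n i where ni: "x = (n, i)" by force
    have i: "i \<in> {0..<P}" using x ni car by simp
    then have "x = (n, 0) \<otimes>\<^bsub>Gp P\<^esub> (0, i)" by (simp add: ni Gp_def)
    then show "f x = g x" using mult[of "(n, 0)" "(0, i)"] fst[of n] snd[of "nat i"] i P by (simp add: car)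
  qed
qed

text \<open>By disjointness, the coefficient of a class in a combination is the value taken on it.
  Conversely, a finite support meets only finitely many classes, and the values on these give the
  combination.\<close>

lemma fin_span_iff:
  fixes f :: "'g \<Rightarrow> 'a::field"
  assumes fin: "\<And>C. C \<in> \<D> \<Longrightarrow> finite C" and ne: "\<And>C. C \<in> \<D> \<Longrightarrow> C \<noteq> {}"
    and disj: "\<And>C D. C \<in> \<D> \<Longrightarrow> D \<in> \<D> \<Longrightarrow> C \<noteq> D \<Longrightarrow> C \<inter> D = {}" and un: "\<Union>\<D> = A"
  shows "f \<in> fin_span \<D> \<longleftrightarrow> f \<in> galg A \<and> (\<forall>C\<in>\<D>. \<forall>x\<in>C. \<forall>y\<in>C. f x = f y)"
proof
  assume "f \<in> fin_span \<D>"
  then obtain B c where B: "finite B" "B \<subseteq> \<D>" and f: "f = (\<lambda>g. \<Sum>E\<in>B. c E * cls_sum E g)"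
    by (auto simp: fin_span_def)
  have val: "f x = (if C \<in> B then c C else 0)" if "C \<in> \<D>" "x \<in> C" for C x
  proof -
    have "f x = (\<Sum>E\<in>B. if E = C then c C else 0)"
      unfolding f
    proof (rule sum.cong[OF refl])
      fix E assume "E \<in> B"
      then show "c E * cls_sum E x = (if E = C then c C else 0)"
        using disj[of E C] that B(2) by (auto simp: cls_sum_def)
    qed
    then show ?thesis using B(1) by simp
  qed
  have "{g. f g \<noteq> 0} \<subseteq> \<Union>B"
  proof
    fix g assume "g \<in> {g. f g \<noteq> 0}"
    then have "(\<Sum>E\<in>B. c E * cls_sum E g) \<noteq> 0" by (simp add: f)
    then obtain E where "E \<in> B" "c E * cls_sum E g \<noteq> 0" by (meson sum.neutral)
    then show "g \<in> \<Union>B" by (auto simp: cls_sum_def split: if_splits)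
  qed
  moreover have "finite (\<Union>B)" using B fin by auto
  moreover have "\<Union>B \<subseteq> A" using B(2) un by auto
  ultimately have "f \<in> galg A" using finite_subset by (auto simp: galg_def)
  then show "f \<in> galg A \<and> (\<forall>C\<in>\<D>. \<forall>x\<in>C. \<forall>y\<in>C. f x = f y)" using val by simp
next
  assume "f \<in> galg A \<and> (\<forall>C\<in>\<D>. \<forall>x\<in>C. \<forall>y\<in>C. f x = f y)"
  then have fA: "f \<in> galg A" and const: "\<And>C x y. C \<in> \<D> \<Longrightarrow> x \<in> C \<Longrightarrow> y \<in> C \<Longrightarrow> f x = f y"
    by blast+
  define r where "r C = (SOME x. x \<in> C)" for C :: "'g set"
  have r: "r C \<in> C" if "C \<in> \<D>" for C using ne[OF that] by (simp add: r_def some_in_eq)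
  define B where "B = {C \<in> \<D>. f (r C) \<noteq> 0}"
  have "inj_on r B"
  proof (rule inj_onI)
    fix C D assume "C \<in> B" "D \<in> B" "r C = r D"
    then show "C = D" using disj[of C D] r[of C] r[of D] by (auto simp: B_def)
  qed
  moreover have "r ` B \<subseteq> {g. f g \<noteq> 0}" by (auto simp: B_def)
  moreover have "finite {g. f g \<noteq> 0}" using fA by (simp add: galg_def)
  ultimately have finB: "finite B" by (rule inj_on_finite)
  have "f g = (\<Sum>E\<in>B. f (r E) * cls_sum E g)" for g
  proof (cases "g \<in> A")
    case True
    then obtain C where C: "C \<in> \<D>" "g \<in> C" using un by blast
    have "(\<Sum>E\<in>B. f (r E) * cls_sum E g) = (\<Sum>E\<in>B. if E = C then f (r C) else 0)"
    proof (rule sum.cong[OF refl])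
      fix E assume "E \<in> B"
      then show "f (r E) * cls_sum E g = (if E = C then f (r C) else 0)"
        using disj[of E C] C by (auto simp: cls_sum_def B_def)
    qed
    also have "\<dots> = f (r C)" using finB C(1) by (simp add: B_def)
    also have "\<dots> = f g" using const[OF C(1) r[OF C(1)] C(2)] .
    finally show ?thesis by simp
  next
    case False
    then have "g \<notin> E" if "E \<in> B" for E using that un by (auto simp: B_def)
    then have "(\<Sum>E\<in>B. f (r E) * cls_sum E g) = 0" by (intro sum.neutral) (simp add: cls_sum_def)
    moreover have "f g = 0" using False fA by (auto simp: galg_def)
    ultimately show ?thesis by simp
  qed
  then have feq: "f = (\<lambda>g. \<Sum>E\<in>B. f (r E) * cls_sum E g)" by (rule ext)
  have "B \<subseteq> \<D>" unfolding B_def by (rule Collect_restrict)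
  then show "f \<in> fin_span \<D>" unfolding fin_span_def mem_Collect_eq
    using finB feq by (intro exI[of _ B] exI[of _ "\<lambda>E. f (r E)"] conjI)
qed

subsection \<open>From Schur rings to relations on coordinates\<close>

text \<open>Each \<open>x\<close> has a unique complementary factor with product
  \<open>(a, b)\<close>, so the convolution is a count.\<close>

lemma conv_cls_sum_Gp:
  assumes P: "P > 0" and C: "finite C" "C \<subseteq> carrier (Gp P)" and D: "D \<subseteq> carrier (Gp P)"
    and b: "b \<in> {0..<P}"
  shows "conv (Gp P) (cls_sum C) (cls_sum D) (a, b)
    = (of_nat (card {x \<in> C. (a - fst x, (b - snd x) mod P) \<in> D}) :: 'a::field)"
proof -
  have supp: "{x. cls_sum C x \<noteq> (0::'a)} = C" for C :: "(int \<times> int) set" by (auto simp: cls_sum_def)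
  have "(\<Sum>y\<in>{y. cls_sum D y \<noteq> (0::'a) \<and> x \<otimes>\<^bsub>Gp P\<^esub> y = (a, b)}. cls_sum C x * cls_sum D y)
      = (if (a - fst x, (b - snd x) mod P) \<in> D then 1 else (0::'a))" if x: "x \<in> C" for x
  proof -
    let ?v = "(a - fst x, (b - snd x) mod P)"
    have iff: "x \<otimes>\<^bsub>Gp P\<^esub> y = (a, b) \<longleftrightarrow> y = ?v" if y: "y \<in> D" for y
    proof -
      have sy: "snd y mod P = snd y" using D y by (auto simp: Gp_def)
      have "x \<otimes>\<^bsub>Gp P\<^esub> y = (a, b) \<longleftrightarrow> fst y = a - fst x \<and> (snd x + snd y) mod P = b mod P"
        using b by (auto simp: Gp_def)
      also have "(snd x + snd y) mod P = b mod P \<longleftrightarrow> snd y mod P = (b - snd x) mod P"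
        by (simp add: mod_eq_dvd_iff algebra_simps)
      finally show ?thesis using sy by (simp add: prod_eq_iff)
    qed
    have "{y. cls_sum D y \<noteq> (0::'a) \<and> x \<otimes>\<^bsub>Gp P\<^esub> y = (a, b)} = (if ?v \<in> D then {?v} else {})"
      using iff by (auto simp: cls_sum_def)
    then show ?thesis using x by (simp add: cls_sum_def)
  qed
  then have "conv (Gp P) (cls_sum C) (cls_sum D) (a, b)
    = (\<Sum>x\<in>C. if (a - fst x, (b - snd x) mod P) \<in> D then 1 else (0::'a))"
    unfolding conv_def supp by (intro sum.cong refl)
  also have "\<dots> = of_nat (card {x \<in> C. (a - fst x, (b - snd x) mod P) \<in> D})"
    using C(1) by (simp add: sum.If_cases Int_def)
  finally show ?thesis .
qed

definition same_class :: "int \<Rightarrow> (int \<times> int) set set \<Rightarrow> int \<Rightarrow> int \<Rightarrow> int \<Rightarrow> int \<Rightarrow> bool" where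
  "same_class P \<D> n i m j \<longleftrightarrow> (\<exists>C\<in>\<D>. (n, i mod P) \<in> C \<and> (m, j mod P) \<in> C)"

lemma schur_ring_mem_iff:
  assumes "schur_ring_on G \<D> S"
  shows "f \<in> S \<longleftrightarrow> f \<in> galg (carrier G) \<and> (\<forall>C\<in>\<D>. \<forall>x\<in>C. \<forall>y\<in>C. f x = f y)"
proof -
  have S: "S = fin_span \<D>" using assms by (simp add: schur_ring_on_def)
  show ?thesis
    unfolding S by (rule fin_span_iff) (use assms in \<open>simp_all add: schur_ring_on_def\<close>)
qed

text \<open>A function of finite support lies in \<open>S\<close> exactly if it is constant on
  classes. Indicators fixed by \<open>H\<close> thus determine the classes of degree 0, and
  convolutions of class sums give \<open>E_conv\<close>.\<close>

lemma schur_classes_same_class: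
  fixes S :: "(int \<times> int \<Rightarrow> 'a::field_char_0) set"
  assumes P: "Factorial_Ring.prime P" and S: "schur_ring_on (Gp P) \<D> S"
    and sub: "S_subgroup (Gp P) \<D> {(P * n, 0) | n. True}"
    and H: "subgroup H (AutoGroup (Zp P))" and SH: "S \<inter> zp_alg P = zp_fixed P H"
  shows "schur_classes P (same_class P \<D>) ((\<lambda>\<sigma>. \<sigma> 1) ` H)"
proof -
  let ?E = "same_class P \<D>"
  have P1: "P > 1" using P by (simp add: prime_gt_1_int)
  have P0: "P > 0" using P1 by simp
  have carG: "carrier (Gp P) = UNIV \<times> {0..<P}" by (simp add: Gp_def)
  have carZ: "carrier (Zp P) = {0..<P}" by (simp add: Zp_def)
  have fin: "finite C" and sub_car: "C \<subseteq> carrier (Gp P)" if "C \<in> \<D>" for C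
    using S that by (auto simp: schur_ring_on_def)
  have disj: "C = D" if "C \<in> \<D>" "D \<in> \<D>" "x \<in> C" "x \<in> D" for C D x
    using S that unfolding schur_ring_on_def by blast
  have ex: "\<exists>C\<in>\<D>. (n, i mod P) \<in> C" for n i
  proof -
    have "(n, i mod P) \<in> \<Union>\<D>" using S P0 by (simp add: schur_ring_on_def carG)
    then show ?thesis by blast
  qed
  have memS: "f \<in> S \<longleftrightarrow> f \<in> galg (carrier (Gp P)) \<and> (\<forall>C\<in>\<D>. \<forall>x\<in>C. \<forall>y\<in>C. f x = f y)" for f
    by (rule schur_ring_mem_iff[OF S])
  have E_iff: "?E n i m j \<longleftrightarrow> (m, j mod P) \<in> C" if "C \<in> \<D>" "(n, i mod P) \<in> C" for C n i m j
    using that disj unfolding same_class_def by blast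
  have cls_S: "(cls_sum C :: _ \<Rightarrow> 'a) \<in> S" if C: "C \<in> \<D>" for C
  proof -
    have "(cls_sum C x :: 'a) = cls_sum C y" if "D \<in> \<D>" "x \<in> D" "y \<in> D" for D x y
      using disj[of C D x] disj[of C D y] C that by (auto simp: cls_sum_def)
    moreover have "{g. cls_sum C g \<noteq> (0::'a)} = C" by (auto simp: cls_sum_def)
    then have "(cls_sum C :: _ \<Rightarrow> 'a) \<in> galg (carrier (Gp P))"
      using fin[OF C] sub_car[OF C] by (simp add: galg_def)
    ultimately show ?thesis unfolding memS by blast
  qed
  have supp_fin: "f \<in> galg (carrier (Gp P))" if "\<And>g. f g \<noteq> 0 \<Longrightarrow> fst g = 0 \<and> snd g \<in> {0..<P}"
    for f :: "int \<times> int \<Rightarrow> 'a"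
  proof -
    have "{g. f g \<noteq> 0} \<subseteq> {0} \<times> {0..<P}" using that by (auto simp: mem_Times_iff)
    moreover from this have "finite {g. f g \<noteq> 0}" by (rule finite_subset) simp
    ultimately show ?thesis by (auto simp: galg_def carG)
  qed
  interpret Z: group "Zp P" by (rule group_Zp[OF P0])
  interpret A: group "AutoGroup (Zp P)" by (rule Z.AutoGroup)
  have H_auto: "\<sigma> \<in> auto (Zp P)" if "\<sigma> \<in> H" for \<sigma> using subgroup.subset[OF H] that by auto
  have H_car: "\<sigma> k \<in> {0..<P}" if "\<sigma> \<in> H" "k \<in> {0..<P}" for \<sigma> k
    using H_auto[OF that(1)] that(2) by (auto simp: auto_def hom_def carZ)
  have H_apply: "\<sigma> k = (\<sigma> 1 * k) mod P" if "\<sigma> \<in> H" "k \<in> {0..<P}" for \<sigma> k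
    by (rule auto_Zp_apply[OF H_auto[OF that(1)] P1 that(2)])
  have H_comp: "\<exists>\<rho>\<in>H. \<rho> k = \<sigma> (\<tau> k)" if "\<sigma> \<in> H" "\<tau> \<in> H" "k \<in> {0..<P}" for \<sigma> \<tau> k
  proof -
    have "\<sigma> \<otimes>\<^bsub>AutoGroup (Zp P)\<^esub> \<tau> \<in> H" using subgroup.m_closed[OF H] that by blast
    then have "compose {0..<P} \<sigma> \<tau> \<in> H" using that H_auto by (simp add: mult_AutoGroup carZ)
    moreover have "compose {0..<P} \<sigma> \<tau> k = \<sigma> (\<tau> k)" using that(3) by (simp add: compose_def)
    ultimately show ?thesis by blast
  qed
  have H_inv: "\<exists>\<rho>\<in>H. \<forall>k\<in>{0..<P}. \<rho> (\<sigma> k) = k" if "\<sigma> \<in> H" for \<sigma>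
    using subgroup.m_inv_closed[OF H that] Z.inv_AutoGroup_apply(1)[OF H_auto[OF that]]
    unfolding carZ by blast
  have H_id: "(\<lambda>x\<in>{0..<P}. x) \<in> H" using subgroup.one_closed[OF H] by (simp add: one_AutoGroup carZ)
  have E_0_deg: "m = 0" if E: "?E 0 i m j" for i m j
  proof -
    \<comment> \<open>The sum of all elements of \<open>Z_p\<close> is fixed by \<open>H\<close>,
      hence lies in \<open>S\<close>; so no class mixes degree 0 with another degree.\<close>
    let ?f = "\<lambda>g::int \<times> int. if fst g = 0 \<and> snd g \<in> {0..<P} then 1 else (0::'a)"
    have "?f \<in> galg (carrier (Gp P))" by (rule supp_fin) (simp split: if_splits)
    then have "?f \<in> zp_fixed P H" using H_car by (auto simp: zp_fixed_def zp_alg_def split: if_splits)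
    then have "?f \<in> S" using SH by blast
    moreover obtain C where "C \<in> \<D>" "(0, i mod P) \<in> C" "(m, j mod P) \<in> C"
      using E unfolding same_class_def by blast
    ultimately have "?f (0, i mod P) = ?f (m, j mod P)" unfolding memS by blast
    then show "m = 0" using P0 by (simp split: if_splits)
  qed
  have E_0_iff: "?E 0 i 0 j \<longleftrightarrow> (\<exists>\<sigma>\<in>H. \<sigma> (i mod P) = j mod P)" for i j
  proof
    have im: "i mod P \<in> {0..<P}" "j mod P \<in> {0..<P}" using P0 by auto
    {
      assume E: "?E 0 i 0 j"
      \<comment> \<open>The indicator of the \<open>H\<close>-orbit of \<open>i\<close> is fixed by
        \<open>H\<close>, so the class of \<open>i\<close> stays within the orbit.\<close>
      let ?f = "\<lambda>g::int \<times> int. if fst g = 0 \<and> (\<exists>\<tau>\<in>H. \<tau> (i mod P) = snd g) then 1 else (0::'a)"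
      have "?f \<in> galg (carrier (Gp P))"
        by (rule supp_fin) (use H_car im in \<open>auto split: if_splits\<close>)
      moreover have "(\<exists>\<tau>\<in>H. \<tau> (i mod P) = \<sigma> k) \<longleftrightarrow> (\<exists>\<tau>\<in>H. \<tau> (i mod P) = k)"
        if \<sigma>: "\<sigma> \<in> H" and k: "k \<in> {0..<P}" for \<sigma> k
      proof
        assume "\<exists>\<tau>\<in>H. \<tau> (i mod P) = \<sigma> k"
        then obtain \<tau> where \<tau>: "\<tau> \<in> H" "\<tau> (i mod P) = \<sigma> k" by blast
        obtain \<rho> where \<rho>: "\<rho> \<in> H" "\<forall>k\<in>{0..<P}. \<rho> (\<sigma> k) = k" using H_inv[OF \<sigma>] by blast
        obtain \<rho>' where "\<rho>' \<in> H" "\<rho>' (i mod P) = \<rho> (\<tau> (i mod P))" using H_comp[OF \<rho>(1) \<tau>(1) im(1)] by blast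
        then have "\<rho>' \<in> H \<and> \<rho>' (i mod P) = k" using \<tau>(2) \<rho>(2) k by simp
        then show "\<exists>\<tau>\<in>H. \<tau> (i mod P) = k" by blast
      next
        assume "\<exists>\<tau>\<in>H. \<tau> (i mod P) = k"
        then obtain \<tau> where \<tau>: "\<tau> \<in> H" "\<tau> (i mod P) = k" by blast
        then show "\<exists>\<tau>\<in>H. \<tau> (i mod P) = \<sigma> k" using H_comp[OF \<sigma> \<tau>(1) im(1)] by simp
      qed
      ultimately have "?f \<in> zp_fixed P H" by (simp add: zp_fixed_def zp_alg_def)
      then have "?f \<in> S" using SH by blast
      moreover obtain C where "C \<in> \<D>" "(0, i mod P) \<in> C" "(0, j mod P) \<in> C"
        using E unfolding same_class_def by blast
      ultimately have "?f (0, i mod P) = ?f (0, j mod P)" unfolding memS by blast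
      moreover have "\<exists>\<tau>\<in>H. \<tau> (i mod P) = i mod P" using H_id im(1) by (intro bexI[OF _ H_id]) simp
      ultimately show "\<exists>\<sigma>\<in>H. \<sigma> (i mod P) = j mod P" by (simp split: if_splits)
    next
      assume "\<exists>\<sigma>\<in>H. \<sigma> (i mod P) = j mod P"
      then obtain \<sigma> where \<sigma>: "\<sigma> \<in> H" "\<sigma> (i mod P) = j mod P" by blast
      obtain C where C: "C \<in> \<D>" "(0, i mod P) \<in> C" using ex by blast
      \<comment> \<open>Conversely, the sum of this class lies in degree 0, hence in
        \<open>zp_fixed P H\<close>, so the class is closed under \<open>H\<close>.\<close>
      have "fst g = 0" if "g \<in> C" for g
      proof -
        have "snd g mod P = snd g" using sub_car[OF C(1)] that by (auto simp: carG)
        then have "(fst g, snd g mod P) \<in> C" using that by simp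
        then have "?E 0 i (fst g) (snd g)" using C unfolding same_class_def by blast
        then show ?thesis by (rule E_0_deg)
      qed
      then have "(cls_sum C :: _ \<Rightarrow> 'a) \<in> zp_alg P"
        using cls_S[OF C(1)] memS by (auto simp: zp_alg_def cls_sum_def split: if_splits)
      then have "(cls_sum C :: _ \<Rightarrow> 'a) \<in> zp_fixed P H" using SH cls_S[OF C(1)] by blast
      then have "(cls_sum C (0, \<sigma> (i mod P)) :: 'a) = cls_sum C (0, i mod P)"
        using \<sigma>(1) im(1) unfolding zp_fixed_def by blast
      then have "(0, j mod P) \<in> C" using C(2) \<sigma>(2) by (simp add: cls_sum_def split: if_splits)
      then show "?E 0 i 0 j" using C unfolding same_class_def by blast
    }
  qed
  have dvd_iff: "\<sigma> (i mod P) = j mod P \<longleftrightarrow> P dvd \<sigma> 1 * i - j" if "\<sigma> \<in> H" for \<sigma> i j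
  proof -
    have "\<sigma> (i mod P) = (\<sigma> 1 * i) mod P" using H_apply[OF that, of "i mod P"] P0 by (simp add: mod_mult_right_eq)
    then show ?thesis by (simp add: mod_eq_dvd_iff)
  qed
  show ?thesis
  proof
    show "Factorial_Ring.prime P" by (rule P)
    show "?E n i n j" if "P dvd i - j" for n i j
    proof -
      have "i mod P = j mod P" using that by (simp add: mod_eq_dvd_iff)
      then show ?thesis using ex[of n i] by (auto simp: same_class_def)
    qed
    show "?E m j n i" if "?E n i m j" for n i m j using that unfolding same_class_def by blast
    show "?E n i k l" if "?E n i m j" "?E m j k l" for n i m j k l
      using that disj unfolding same_class_def by blast
    show "finite {(m, j). j \<in> {0..<P} \<and> ?E n i m j}" for n i
    proof -
      obtain C where C: "C \<in> \<D>" "(n, i mod P) \<in> C" using ex by blast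
      have "{(m, j). j \<in> {0..<P} \<and> ?E n i m j} \<subseteq> C" by (auto simp: E_iff[OF C])
      then show ?thesis using fin[OF C(1)] by (rule finite_subset)
    qed
    show "?E (- n) (- i) (- m) (- j)" if "?E n i m j" for n i m j
    proof -
      obtain C where C: "C \<in> \<D>" "(n, i mod P) \<in> C" "(m, j mod P) \<in> C"
        using \<open>?E n i m j\<close> unfolding same_class_def by blast
      have inv: "(- n, (- i) mod P) = inv\<^bsub>Gp P\<^esub> (n, i mod P)" for n i
        using P0 by (simp add: inv_Gp mod_minus_eq)
      have CD: "(\<lambda>x. inv\<^bsub>Gp P\<^esub> x) ` C \<in> \<D>" using S C(1) by (simp add: schur_ring_on_def)
      have mem: "(- n, (- i) mod P) \<in> (\<lambda>x. inv\<^bsub>Gp P\<^esub> x) ` C"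
        "(- m, (- j) mod P) \<in> (\<lambda>x. inv\<^bsub>Gp P\<^esub> x) ` C"
        unfolding inv by (rule imageI[OF C(2)], rule imageI[OF C(3)])
      show ?thesis unfolding same_class_def by (rule bexI[OF _ CD]) (rule conjI[OF mem])
    qed
    show "card {(m, j). j \<in> {0..<P} \<and> ?E n i m j \<and> ?E u v (a - m) (b - j)} =
      card {(m, j). j \<in> {0..<P} \<and> ?E n i m j \<and> ?E u v (a' - m) (b' - j)}"
      if E: "?E a b a' b'" for a b a' b' n i u v
    proof -
      obtain C where C: "C \<in> \<D>" "(n, i mod P) \<in> C" using ex by blast
      obtain D where D: "D \<in> \<D>" "(u, v mod P) \<in> D" using ex by blast
      obtain B where B: "B \<in> \<D>" "(a, b mod P) \<in> B" "(a', b' mod P) \<in> B"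
        using E unfolding same_class_def by blast
      have set_eq: "{(m, j). j \<in> {0..<P} \<and> ?E n i m j \<and> ?E u v (a - m) (b - j)}
        = {x \<in> C. (a - fst x, (b mod P - snd x) mod P) \<in> D}" for a b
        using sub_car[OF C(1)] by (auto simp: E_iff[OF C] E_iff[OF D] mod_diff_left_eq carG)
      have "\<forall>C\<in>\<D>. \<forall>D\<in>\<D>. conv (Gp P) (cls_sum C) (cls_sum D) \<in> S"
        using S unfolding schur_ring_on_def by (elim conjE)
      then have "(conv (Gp P) (cls_sum C) (cls_sum D) :: _ \<Rightarrow> 'a) \<in> S"
        using C(1) D(1) by simp
      then have "(conv (Gp P) (cls_sum C) (cls_sum D) (a, b mod P) :: 'a)
          = conv (Gp P) (cls_sum C) (cls_sum D) (a', b' mod P)"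
        using B unfolding memS by blast
      moreover have "(conv (Gp P) (cls_sum C) (cls_sum D) (a, b mod P) :: 'a)
        = of_nat (card {x \<in> C. (a - fst x, (b mod P - snd x) mod P) \<in> D})" for a b
        by (rule conv_cls_sum_Gp[OF P0 fin[OF C(1)] sub_car[OF C(1)] sub_car[OF D(1)]]) (use P0 in simp)
      \<comment> \<open>Characteristic 0 turns equality of the coefficients into equality of the
        cardinalities.\<close>
      ultimately show ?thesis unfolding set_eq by (simp only: of_nat_eq_iff)
    qed
    show "?E 0 i m j \<longleftrightarrow> m = 0 \<and> (\<exists>h\<in>(\<lambda>\<sigma>. \<sigma> 1) ` H. P dvd h * i - j)" for i m j
    proof -
      have "(\<exists>\<sigma>\<in>H. \<sigma> (i mod P) = j mod P) \<longleftrightarrow> (\<exists>h\<in>(\<lambda>\<sigma>. \<sigma> 1) ` H. P dvd h * i - j)"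
        using dvd_iff[of _ i j] by blast
      then show ?thesis using E_0_deg[of i m j] E_0_iff[of i j] by blast
    qed
    show "P dvd m \<and> P dvd j" if E: "?E (P * n) 0 m j" for n m j
    proof -
      let ?T = "{(P * n, 0) | n. True} :: (int \<times> int) set"
      obtain C where C: "C \<in> \<D>" "(P * n, 0 mod P) \<in> C" "(m, j mod P) \<in> C"
        using E unfolding same_class_def by blast
      have T: "?T = \<Union>{C \<in> \<D>. C \<subseteq> ?T}" using sub by (simp add: S_subgroup_def)
      have "(P * n, 0) \<in> ?T" by blast
      then obtain D where D: "D \<in> \<D>" "D \<subseteq> ?T" "(P * n, 0) \<in> D" by (subst (asm) T) blast
      then have "C = D" using disj[OF C(1) D(1), of "(P * n, 0)"] C(2) by simp
      then have "(m, j mod P) \<in> ?T" using C(3) D(2) by blast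
      then show ?thesis by (auto simp: dvd_eq_mod_eq_0)
    qed
    show "(\<lambda>\<sigma>. \<sigma> 1) ` H \<subseteq> {1..<P}"
    proof (rule image_subsetI)
      fix \<sigma> assume \<sigma>: "\<sigma> \<in> H"
      have r: "\<sigma> 1 \<in> {0..<P}" using H_car[OF \<sigma>] P1 by simp
      obtain \<rho> where \<rho>: "\<rho> \<in> H" "\<forall>k\<in>{0..<P}. \<rho> (\<sigma> k) = k" using H_inv[OF \<sigma>] by blast
      have "\<rho> (\<sigma> 1) = 1" using \<rho>(2) P1 by simp
      moreover have "\<rho> 0 = 0" using H_apply[OF \<rho>(1), of 0] P0 by simp
      ultimately have "\<sigma> 1 \<noteq> 0" by auto
      then show "\<sigma> 1 \<in> {1..<P}" using r by simp
    qed
  qed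
qed

section \<open>The group of class-preserving automorphisms\<close>

theorem theorem3p9:
  fixes p :: nat and \<D> :: "(int \<times> int) set set"
    and S :: "(int \<times> int \<Rightarrow> 'a::field_char_0) set"
    and H :: "(int \<Rightarrow> int) set" and m :: nat
  assumes "Factorial_Ring.prime p"
    and "schur_ring_on (Gp (int p)) \<D> S"
    and "S_subgroup (Gp (int p)) \<D> {(int p * n, 0) | n. True}"
    and "subgroup H (AutoGroup (Zp (int p)))"
    and "S \<inter> zp_alg (int p) = zp_fixed (int p) H"
    and "card H = m"
    and "\<exists>q k. Factorial_Ring.prime (q::nat) \<and> m = q ^ k"
  shows "automorphic (Gp (int p)) S"
proof -
  define P where "P = int p"
  have P: "Factorial_Ring.prime P" using assms(1) by (simp add: P_def)
  then have P1: "P > 1" by (rule prime_gt_1_int)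
  have P0: "P > 0" using P1 by simp
  note S = assms(2)[folded P_def] and H = assms(4)[folded P_def]
  define K where "K = (\<lambda>\<sigma>. \<sigma> 1) ` H"
  interpret schur_classes P "same_class P \<D>" K
    unfolding K_def by (rule schur_classes_same_class[OF P S assms(3)[folded P_def] H assms(5)[folded P_def]])
  interpret G: group "Gp P" by (rule group_Gp[OF P0])
  interpret A: group "AutoGroup (Gp P)" by (rule G.AutoGroup)
  have carG: "carrier (Gp P) = UNIV \<times> {0..<P}" by (simp add: Gp_def)
  \<comment> \<open>An automorphism of \<open>Z_p\<close> is determined by its multiplier, so
    \<open>K\<close> has as many elements as \<open>H\<close>.\<close>
  have "inj_on (\<lambda>\<sigma>. \<sigma> 1) H"
  proof (rule inj_onI)
    fix \<sigma> \<tau> assume st: "\<sigma> \<in> H" "\<tau> \<in> H" "\<sigma> 1 = \<tau> 1"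
    then have auto: "\<sigma> \<in> auto (Zp P)" "\<tau> \<in> auto (Zp P)" using subgroup.subset[OF H] by auto
    show "\<sigma> = \<tau>"
    proof (rule extensionalityI)
      show "\<sigma> \<in> extensional {0..<P}" "\<tau> \<in> extensional {0..<P}"
        using auto by (auto simp: auto_def Bij_def Zp_def)
      show "\<sigma> i = \<tau> i" if "i \<in> {0..<P}" for i
        using auto_Zp_apply[OF auto(1) P1 that] auto_Zp_apply[OF auto(2) P1 that] st(3) by simp
    qed
  qed
  then have cardK: "card K = m" using assms(6) by (simp add: K_def card_image)
  obtain q k where q: "Factorial_Ring.prime (q::nat)" "card K = q ^ k" using assms(7) cardK by blast
  define rel where "rel x y \<longleftrightarrow> same_class P \<D> (fst x) (snd x) (fst y) (snd y)" for x y :: "int \<times> int"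
  have sub_car: "C \<subseteq> carrier (Gp P)" if "C \<in> \<D>" for C using S that by (simp add: schur_ring_on_def)
  have rel_iff: "rel x y \<longleftrightarrow> (\<exists>C\<in>\<D>. x \<in> C \<and> y \<in> C)"
    if "x \<in> carrier (Gp P)" "y \<in> carrier (Gp P)" for x y
  proof -
    have "(fst x, snd x mod P) = x" "(fst y, snd y mod P) = y" using that by (auto simp: carG)
    then show ?thesis by (simp add: rel_def same_class_def)
  qed
  \<comment> \<open>All automorphisms that map each class into itself; by transitivity its orbits
    turn out to be the classes.\<close>
  define H' where "H' = {\<sigma> \<in> auto (Gp P). \<forall>x\<in>carrier (Gp P). rel x (\<sigma> x)}"
  have auto_car: "\<sigma> x \<in> carrier (Gp P)" if "\<sigma> \<in> auto (Gp P)" "x \<in> carrier (Gp P)" for \<sigma> x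
    using that by (auto simp: auto_def hom_def)
  have rel_trans: "rel x y \<Longrightarrow> rel y w \<Longrightarrow> rel x w" for x y w unfolding rel_def by (rule E_trans)
  have rel_sym: "rel x y \<Longrightarrow> rel y x" for x y unfolding rel_def by (rule E_sym)
  have "subgroup H' (AutoGroup (Gp P))"
  proof (rule A.subgroupI)
    show "H' \<subseteq> carrier (AutoGroup (Gp P))" by (auto simp: H'_def)
    have "(\<lambda>x\<in>carrier (Gp P). x) \<in> H'"
      using G.id_in_auto by (simp add: H'_def rel_def)
    then show "H' \<noteq> {}" by blast
    show "inv\<^bsub>AutoGroup (Gp P)\<^esub> \<sigma> \<in> H'" if \<sigma>: "\<sigma> \<in> H'" for \<sigma>
    proof -
      have au: "\<sigma> \<in> auto (Gp P)" using \<sigma> by (simp add: H'_def)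
      have "inv\<^bsub>AutoGroup (Gp P)\<^esub> \<sigma> \<in> auto (Gp P)" using A.inv_closed[of \<sigma>] au by simp
      moreover have "rel x ((inv\<^bsub>AutoGroup (Gp P)\<^esub> \<sigma>) x)" if x: "x \<in> carrier (Gp P)" for x
      proof -
        have "rel ((inv\<^bsub>AutoGroup (Gp P)\<^esub> \<sigma>) x) (\<sigma> ((inv\<^bsub>AutoGroup (Gp P)\<^esub> \<sigma>) x))"
          using \<sigma> G.inv_AutoGroup_apply(3)[OF au x] unfolding H'_def by blast
        then show ?thesis using G.inv_AutoGroup_apply(2)[OF au x] rel_sym by simp
      qed
      ultimately show ?thesis unfolding H'_def by blast
    qed
    show "\<sigma> \<otimes>\<^bsub>AutoGroup (Gp P)\<^esub> \<tau> \<in> H'" if \<sigma>\<tau>: "\<sigma> \<in> H'" "\<tau> \<in> H'" for \<sigma> \<tau>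
    proof -
      have au: "\<sigma> \<in> auto (Gp P)" "\<tau> \<in> auto (Gp P)" using \<sigma>\<tau> by (auto simp: H'_def)
      have "\<sigma> \<otimes>\<^bsub>AutoGroup (Gp P)\<^esub> \<tau> \<in> auto (Gp P)" using A.m_closed[of \<sigma> \<tau>] au by simp
      moreover have "rel x ((\<sigma> \<otimes>\<^bsub>AutoGroup (Gp P)\<^esub> \<tau>) x)" if x: "x \<in> carrier (Gp P)" for x
      proof -
        have "rel x (\<tau> x)" "rel (\<tau> x) (\<sigma> (\<tau> x))"
          using \<sigma>\<tau> x auto_car[OF au(2) x] unfolding H'_def by blast+
        then have "rel x (\<sigma> (\<tau> x))" by (rule rel_trans)
        then show ?thesis using x by (simp add: mult_AutoGroup[OF au] compose_def)
      qed
      ultimately show ?thesis unfolding H'_def by blast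
    qed
  qed
  moreover have "finite H'"
  proof -
    have "(1, 0) \<in> carrier (Gp P)" "(0, 1) \<in> carrier (Gp P)" using P1 by (simp_all add: carG)
    have mem_cls: "\<sigma> x \<in> cls (fst x) (snd x)" if "\<sigma> \<in> H'" "x \<in> carrier (Gp P)" for \<sigma> x
    proof -
      have "\<sigma> x \<in> carrier (Gp P)" "rel x (\<sigma> x)" using that auto_car by (auto simp: H'_def)
      then show ?thesis by (simp add: cls_def rel_def carG case_prod_unfold mem_Times_iff)
    qed
    \<comment> \<open>Members of \<open>H'\<close> are determined by the images of \<open>z\<close>
      and \<open>a\<close>, which stay in two finite classes.\<close>
    have "inj_on (\<lambda>\<sigma>. (\<sigma> (1, 0), \<sigma> (0, 1))) H'"
      by (rule inj_onI) (rule auto_Gp_eqI[OF P1], auto simp: H'_def)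
    moreover have "(\<lambda>\<sigma>. (\<sigma> (1, 0), \<sigma> (0, 1))) ` H' \<subseteq> cls 1 0 \<times> cls 0 1"
      using mem_cls[of _ "(1, 0)"] mem_cls[of _ "(0, 1)"] P1 by (auto simp: carG)
    ultimately show ?thesis by (rule inj_on_finite) simp
  qed
  moreover have "S = fixed_alg (Gp P) H'"
  proof (rule Set.set_eqI)
    fix f :: "int \<times> int \<Rightarrow> 'a"
    have trans: "\<exists>\<sigma>\<in>H'. \<sigma> x = y" if C: "C \<in> \<D>" "x \<in> C" "y \<in> C" for C x y
    proof -
      have car: "x \<in> carrier (Gp P)" "y \<in> carrier (Gp P)" using C sub_car by blast+
      have "rel x y" using C rel_iff[OF car] by blast
      then obtain e h c where ehc: "\<not> P dvd h" "e \<in> {1, -1}"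
        "\<And>a b. same_class P \<D> a b (e * a) (h * b + c * a)"
        "fst y = e * fst x" "P dvd h * snd x + c * fst x - snd y"
        unfolding rel_def using transitive_on_classes[OF q] by metis
      define \<sigma> where "\<sigma> = (\<lambda>x\<in>carrier (Gp P). (e * fst x, (h * snd x + c * fst x) mod P))"
      have "\<sigma> \<in> auto (Gp P)" unfolding \<sigma>_def by (rule affine_auto_Gp[OF P ehc(2,1)])
      moreover have "rel w (\<sigma> w)" if "w \<in> carrier (Gp P)" for w
        using ehc(3)[of "fst w" "snd w"] that by (simp add: \<sigma>_def rel_def)
      ultimately have "\<sigma> \<in> H'" by (simp add: H'_def)
      moreover have "\<sigma> x = y"
      proof -
        have "(h * snd x + c * fst x) mod P = snd y mod P" using ehc(5) by (simp add: mod_eq_dvd_iff)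
        also have "\<dots> = snd y" using car(2) by (auto simp: carG)
        finally show ?thesis using car(1) ehc(4) by (simp add: \<sigma>_def prod_eq_iff)
      qed
      ultimately show ?thesis by blast
    qed
    show "f \<in> S \<longleftrightarrow> f \<in> fixed_alg (Gp P) H'"
    proof
      assume "f \<in> S"
      then have f: "f \<in> galg (carrier (Gp P))" "\<And>C x y. C \<in> \<D> \<Longrightarrow> x \<in> C \<Longrightarrow> y \<in> C \<Longrightarrow> f x = f y"
        unfolding schur_ring_mem_iff[OF S] by blast+
      have "f (\<sigma> x) = f x" if \<sigma>: "\<sigma> \<in> H'" and x: "x \<in> carrier (Gp P)" for \<sigma> x
      proof -
        have "rel x (\<sigma> x)" "\<sigma> x \<in> carrier (Gp P)" using \<sigma> x auto_car by (auto simp: H'_def)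
        then obtain C where "C \<in> \<D>" "x \<in> C" "\<sigma> x \<in> C" using rel_iff[OF x] by blast
        then show ?thesis using f(2) by blast
      qed
      then show "f \<in> fixed_alg (Gp P) H'" using f(1) unfolding fixed_alg_def by blast
    next
      assume "f \<in> fixed_alg (Gp P) H'"
      then have f: "f \<in> galg (carrier (Gp P))" "\<And>\<sigma> x. \<sigma> \<in> H' \<Longrightarrow> x \<in> carrier (Gp P) \<Longrightarrow> f (\<sigma> x) = f x"
        unfolding fixed_alg_def by blast+
      have "f x = f y" if C: "C \<in> \<D>" "x \<in> C" "y \<in> C" for C x y
        using trans[OF C] f(2)[of _ x] sub_car[OF C(1)] C(2) by force
      then show "f \<in> S" using f(1) unfolding schur_ring_mem_iff[OF S] by blast
    qed
  qed
  ultimately show ?thesis unfolding automorphic_def P_def[symmetric] by blast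
qed

end
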